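(* Let $G$ be a nontrivial cactus on $n$ vertices with $k$ cycles, Randi\'c index $R$ and diameter $d$. Then \[R-d\geq -(k-1)\left(2-\sqrt 2\right)\qquad\text{and}\qquad R-\frac{d}{2}\geq \frac{n}{4}-(k-1)\left(\frac{7}{4}-\sqrt 2\right),\] with equality if the BC-tree of $G$ is a path and $G$ is longitudinally symmetric.
   Context: A cactus is a connected graph in which any two cycles share at most one vertex; it is nontrivial if it has no bridges (edges whose removal disconnects the graph). An articulation point is a vertex whose removal disconnects the graph; a block is a maximal connected subgraph with no articulation point of its own. The BC-tree has a vertex for each block and each articulation point, with an articulation point joined to each block containing it. A cactus whose BC-tree is a path is longitudinally symmetric if every cycle $c$ has an even number $s_c$ of vertices and any two articulation points of $G$ lying on $c$ are at distance $s_c/2$ from each other. The Randi\'c index is $R(G)=\sum_{uv\in E(G)}\frac{1}{\sqrt{d_ud_v}}$, where $d_v$ is the degree of $v$; the diameter is the maximum distance between two vertices.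
   Formalization: The graph is required to have at least two vertices, since the one-vertex graph is a bridgeless cactus with k = 0 and R = d = 0 for which both inequalities fail. *)

theory Defs
  imports Complex_Main
begin

definition simple_graph :: "'a set \<Rightarrow> 'a set set \<Rightarrow> bool" where
  "simple_graph V E \<longleftrightarrow> finite V \<and> (\<forall>e\<in>E. e \<subseteq> V \<and> card e = 2)"

text \<open>A walk in (V,E) from u to v, given as its vertex sequence; its length is length xs - 1.\<close>
definition is_walk :: "'a set \<Rightarrow> 'a set set \<Rightarrow> 'a list \<Rightarrow> 'a \<Rightarrow> 'a \<Rightarrow> bool" where
  "is_walk V E xs u v \<longleftrightarrow> xs \<noteq> [] \<and> hd xs = u \<and> last xs = v \<and> set xs \<subseteq> V \<and>
     (\<forall>i. i + 1 < length xs \<longrightarrow> {xs ! i, xs ! (i + 1)} \<in> E)"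

definition joined :: "'a set \<Rightarrow> 'a set set \<Rightarrow> 'a \<Rightarrow> 'a \<Rightarrow> bool" where
  "joined V E u v \<longleftrightarrow> (\<exists>xs. is_walk V E xs u v)"

definition connected_graph :: "'a set \<Rightarrow> 'a set set \<Rightarrow> bool" where
  "connected_graph V E \<longleftrightarrow> V \<noteq> {} \<and> (\<forall>u\<in>V. \<forall>v\<in>V. joined V E u v)"

definition gdist :: "'a set \<Rightarrow> 'a set set \<Rightarrow> 'a \<Rightarrow> 'a \<Rightarrow> nat" where
  "gdist V E u v = (LEAST n. \<exists>xs. is_walk V E xs u v \<and> length xs = n + 1)"

definition diameter :: "'a set \<Rightarrow> 'a set set \<Rightarrow> nat" where
  "diameter V E = Max {gdist V E u v | u v. u \<in> V \<and> v \<in> V}"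

definition degree :: "'a set set \<Rightarrow> 'a \<Rightarrow> nat" where
  "degree E v = card {e \<in> E. v \<in> e}"

definition randic :: "'a set set \<Rightarrow> real" where
  "randic E = (\<Sum>e\<in>E. 1 / sqrt (\<Prod>v\<in>e. real (degree E v)))"

definition cycle_edges :: "'a list \<Rightarrow> 'a set set" where
  "cycle_edges vs = {{vs ! i, vs ! ((i + 1) mod length vs)} | i. i < length vs}"

definition graph_cycles :: "'a set \<Rightarrow> 'a set set \<Rightarrow> 'a set set set" where
  "graph_cycles V E = {cycle_edges vs | vs. distinct vs \<and> length vs \<ge> 3 \<and> set vs \<subseteq> V
      \<and> cycle_edges vs \<subseteq> E}"

definition cactus :: "'a set \<Rightarrow> 'a set set \<Rightarrow> bool" where
  "cactus V E \<longleftrightarrow> simple_graph V E \<and> connected_graph V E \<and>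
     (\<forall>C1\<in>graph_cycles V E. \<forall>C2\<in>graph_cycles V E. C1 \<noteq> C2 \<longrightarrow> card (\<Union>C1 \<inter> \<Union>C2) \<le> 1)"

definition is_bridge :: "'a set \<Rightarrow> 'a set set \<Rightarrow> 'a set \<Rightarrow> bool" where
  "is_bridge V E e \<longleftrightarrow> e \<in> E \<and> (\<exists>u\<in>V. \<exists>v\<in>V. \<not> joined V (E - {e}) u v)"

definition nontrivial_cactus :: "'a set \<Rightarrow> 'a set set \<Rightarrow> bool" where
  "nontrivial_cactus V E \<longleftrightarrow> cactus V E \<and> (\<forall>e\<in>E. \<not> is_bridge V E e)"

definition is_artic :: "'a set \<Rightarrow> 'a set set \<Rightarrow> 'a \<Rightarrow> bool" where
  "is_artic V E v \<longleftrightarrow> v \<in> V \<and>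
     (\<exists>u\<in>V - {v}. \<exists>w\<in>V - {v}. \<not> joined (V - {v}) {e \<in> E. v \<notin> e} u w)"

definition subgraph :: "'a set \<Rightarrow> 'a set set \<Rightarrow> 'a set \<Rightarrow> 'a set set \<Rightarrow> bool" where
  "subgraph W F V E \<longleftrightarrow> W \<subseteq> V \<and> F \<subseteq> E \<and> (\<forall>e\<in>F. e \<subseteq> W)"

definition block_cand :: "'a set \<Rightarrow> 'a set set \<Rightarrow> 'a set \<Rightarrow> 'a set set \<Rightarrow> bool" where
  "block_cand V E W F \<longleftrightarrow> subgraph W F V E \<and> connected_graph W F \<and> (\<forall>v\<in>W. \<not> is_artic W F v)"

definition is_block :: "'a set \<Rightarrow> 'a set set \<Rightarrow> 'a set \<times> 'a set set \<Rightarrow> bool" where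
  "is_block V E B \<longleftrightarrow> block_cand V E (fst B) (snd B) \<and>
     (\<forall>W' F'. block_cand V E W' F' \<and> fst B \<subseteq> W' \<and> snd B \<subseteq> F' \<longrightarrow> (W', F') = B)"

definition bc_vertices :: "'a set \<Rightarrow> 'a set set \<Rightarrow> ('a + ('a set \<times> 'a set set)) set" where
  "bc_vertices V E = Inl ` {v. is_artic V E v} \<union> Inr ` {B. is_block V E B}"

definition bc_edges :: "'a set \<Rightarrow> 'a set set \<Rightarrow> ('a + ('a set \<times> 'a set set)) set set" where
  "bc_edges V E = {{Inl a, Inr B} | a B. is_artic V E a \<and> is_block V E B \<and> a \<in> fst B}"

definition is_path_graph :: "'b set \<Rightarrow> 'b set set \<Rightarrow> bool" where
  "is_path_graph V E \<longleftrightarrow> (\<exists>vs. distinct vs \<and> set vs = V \<and>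
      E = {{vs ! i, vs ! (i + 1)} | i. i + 1 < length vs})"

definition bc_tree_is_path :: "'a set \<Rightarrow> 'a set set \<Rightarrow> bool" where
  "bc_tree_is_path V E \<longleftrightarrow> is_path_graph (bc_vertices V E) (bc_edges V E)"

text \<open>Longitudinal symmetry (for a cactus whose BC-tree is a path).\<close>
definition long_symmetric :: "'a set \<Rightarrow> 'a set set \<Rightarrow> bool" where
  "long_symmetric V E \<longleftrightarrow> (\<forall>C\<in>graph_cycles V E.
      even (card (\<Union>C)) \<and>
      (\<forall>u\<in>\<Union>C. \<forall>v\<in>\<Union>C. is_artic V E u \<and> is_artic V E v \<and> u \<noteq> v \<longrightarrow>
          2 * gdist V E u v = card (\<Union>C)))"

end

theory Submission
  imports Defs
begin

text \<open>
  Every edge lies on exactly one cycle, so a vertex on \<open>s\<close> cycles has degree \<open>2 s\<close>. Expanding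
  \<open>(1/\<surd>2 - 1/\<surd>d\<^sub>a) (1/\<surd>2 - 1/\<surd>d\<^sub>b) \<ge> 0\<close> over all edges \<open>ab\<close> gives \<open>R \<ge> (\<Sum>\<^sub>x \<surd>s\<^sub>x) - m/2\<close>,
  where \<open>m\<close> is the number of edges.

  Root the cactus at a vertex \<open>u\<close> and let the root of a cycle be its vertex nearest to \<open>u\<close>. Each
  vertex other than \<open>u\<close> is a non-root vertex of exactly one cycle, its parent cycle; hence
  \<open>m = n + k - 1\<close>. Following parent cycles from \<open>w\<close> to \<open>u\<close> bounds \<open>2 d(u,w)\<close> by the total length of
  the cycles used, and at a vertex on \<open>s\<close> cycles at least \<open>s - 2\<close> of the cycles rooted there are
  unused, so \<open>2 d + 3 \<Sum>\<^sub>x max(s\<^sub>x - 2, 0) \<le> m\<close>. With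
  \<open>\<surd>s \<ge> s - (s - 1)(2 - \<surd>2) - (\<surd>2 - 1) max(s - 2, 0)\<close> this yields
  \<open>R \<ge> d/2 + m/4 - (k - 1)(2 - \<surd>2)\<close>, and both inequalities follow from \<open>2 d \<le> m\<close>.

  If the BC-tree is a path and the cactus is longitudinally symmetric, then all \<open>s\<^sub>x \<le> 2\<close>, no two
  articulation points are adjacent, and rooting at the far end of a leaf cycle gives \<open>2 d = m\<close>, so
  all the estimates are equalities.
\<close>

section \<open>Walks, connectivity and distances\<close>

lemma is_walk_successively:
  "is_walk V E xs u v \<longleftrightarrow> xs \<noteq> [] \<and> hd xs = u \<and> last xs = v \<and> set xs \<subseteq> V \<and>
     successively (\<lambda>a b. {a, b} \<in> E) xs"
  by (simp add: is_walk_def successively_conv_nth)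

lemma is_walk_append:
  assumes "is_walk V E xs u v" "is_walk V E ys v w"
  shows "is_walk V E (xs @ tl ys) u w"
proof -
  obtain zs where "ys = v # zs"
    using assms(2) by (cases ys) (auto simp: is_walk_successively)
  then show ?thesis
    using assms by (cases zs) (auto simp: is_walk_successively successively_append_iff)
qed

lemma is_walk_rev: "is_walk V E xs u v \<Longrightarrow> is_walk V E (rev xs) v u"
  by (auto simp: is_walk_successively hd_rev last_rev insert_commute)

lemma is_walk_edge: "{a, b} \<in> E \<Longrightarrow> a \<in> V \<Longrightarrow> b \<in> V \<Longrightarrow> is_walk V E [a, b] a b"
  by (simp add: is_walk_successively)

lemma joined_refl: "a \<in> V \<Longrightarrow> joined V E a a"
  unfolding joined_def by (rule exI[of _ "[a]"]) (simp add: is_walk_successively)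

lemma joined_sym: "joined V E a b \<Longrightarrow> joined V E b a"
  unfolding joined_def using is_walk_rev by metis

lemma joined_trans: "joined V E a b \<Longrightarrow> joined V E b c \<Longrightarrow> joined V E a c"
  unfolding joined_def using is_walk_append by metis

lemma joined_edge: "{a, b} \<in> E \<Longrightarrow> a \<in> V \<Longrightarrow> b \<in> V \<Longrightarrow> joined V E a b"
  unfolding joined_def using is_walk_edge by metis

lemma joined_mono: "joined V E a b \<Longrightarrow> V \<subseteq> V' \<Longrightarrow> E \<subseteq> E' \<Longrightarrow> joined V' E' a b"
  unfolding joined_def is_walk_def by blast

lemma joined_ends: "joined V E a b \<Longrightarrow> a \<in> V \<and> b \<in> V"
  unfolding joined_def is_walk_def by (metis hd_in_set last_in_set subsetD)

text \<open>A shortest walk repeats no vertex, because the loop between two visits could be cut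
  out.\<close>

lemma joined_distinct_walk:
  assumes "joined V E u v"
  obtains xs where "is_walk V E xs u v" "distinct xs"
proof -
  obtain xs where xs: "is_walk V E xs u v"
    and min: "\<And>ys. is_walk V E ys u v \<Longrightarrow> length xs \<le> length ys"
    using assms ex_has_least_nat[of "\<lambda>xs. is_walk V E xs u v" _ length]
    unfolding joined_def by blast
  have "distinct xs"
  proof (rule ccontr)
    assume "\<not> distinct xs"
    then obtain as bs cs y where eq: "xs = as @ [y] @ bs @ [y] @ cs"
      using not_distinct_decomp by blast
    have "is_walk V E (as @ [y] @ cs) u v"
      using xs unfolding eq is_walk_successively
      by (cases "as = []"; cases "cs = []")
        (auto simp: successively_append_iff successively_Cons hd_append)
    from min[OF this] show False by (simp add: eq)
  qed
  with xs show thesis by (rule that)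
qed

lemma joined_along_list:
  assumes "successively (\<lambda>a b. {a, b} \<in> E) xs" "set xs \<subseteq> V" "a \<in> set xs" "b \<in> set xs"
  shows "joined V E a b"
proof -
  have "joined V E (hd xs) c" if "c \<in> set xs" for c
    using assms(1,2) that
  proof (induction xs)
    case Nil
    then show ?case by simp
  next
    case (Cons y ys)
    show ?case
    proof (cases "c = y")
      case True
      then show ?thesis using Cons.prems by (simp add: joined_refl)
    next
      case False
      then have c: "c \<in> set ys" using Cons.prems by simp
      moreover have "hd ys \<in> set ys" using c by (cases ys) auto
      ultimately have "{y, hd ys} \<in> E" "hd ys \<in> V" "joined V E (hd ys) c"
        using Cons by (auto simp: successively_Cons)
      then show ?thesis
        using Cons.prems by (auto intro: joined_trans joined_edge)
    qed
  qed
  then show ?thesis using assms(3,4) joined_sym joined_trans by metis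
qed

lemma gdist_le: "is_walk V E xs u v \<Longrightarrow> gdist V E u v \<le> length xs - 1"
  unfolding gdist_def by (rule Least_le, rule exI[of _ xs]) (simp add: is_walk_def)

text \<open>\<open>gdist\<close> is a \<open>LEAST\<close>, which says nothing unless some walk
  exists; \<open>joined\<close> supplies one, so the minimum is attained.\<close>

lemma gdist_walk:
  assumes "joined V E u v"
  obtains xs where "is_walk V E xs u v" "length xs = gdist V E u v + 1"
proof -
  obtain xs where xs: "is_walk V E xs u v" using assms unfolding joined_def by blast
  then have "length xs = (length xs - 1) + 1" by (simp add: is_walk_def)
  with xs have "\<exists>n xs. is_walk V E xs u v \<and> length xs = n + 1" by blast
  then have "\<exists>xs. is_walk V E xs u v \<and> length xs = gdist V E u v + 1"
    unfolding gdist_def by (rule LeastI_ex)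
  with that show thesis by blast
qed

lemma gdist_self: "u \<in> V \<Longrightarrow> gdist V E u u = 0"
  using gdist_le[of V E "[u]" u u] by (simp add: is_walk_def)

lemma gdist_edge:
  assumes "joined V E u a" "{a, b} \<in> E" "a \<in> V" "b \<in> V"
  shows "gdist V E u b \<le> gdist V E u a + 1"
proof -
  obtain xs where xs: "is_walk V E xs u a" "length xs = gdist V E u a + 1"
    using gdist_walk[OF assms(1)] .
  have "is_walk V E (xs @ tl [a, b]) u b"
    using is_walk_append[OF xs(1) is_walk_edge[OF assms(2-4)]] .
  from gdist_le[OF this] show ?thesis using xs by simp
qed

text \<open>Removing the last vertex of a shortest walk leaves a shortest walk to a neighbour. All
  later inductions towards the root of the cactus descend by this step.\<close>

lemma gdist_predecessor:
  assumes "joined V E u x" "x \<noteq> u"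
  obtains y where "y \<in> V" "{y, x} \<in> E" "joined V E u y" "gdist V E u x = gdist V E u y + 1"
proof -
  obtain xs where xs: "is_walk V E xs u x" "length xs = gdist V E u x + 1"
    using gdist_walk[OF assms(1)] .
  have "xs = butlast xs @ [x]" using xs(1) by (simp add: is_walk_def) (metis append_butlast_last_id)
  then obtain ys where ys: "xs = ys @ [x]" by blast
  have ne: "ys \<noteq> []" using xs ys assms(2) by (auto simp: is_walk_def)
  have w: "is_walk V E ys u (last ys)" and e: "{last ys, x} \<in> E"
    using xs(1) ne unfolding ys is_walk_successively by (auto simp: successively_append_iff)
  have J: "joined V E u (last ys)" using w unfolding joined_def by blast
  then have yV: "last ys \<in> V" using joined_ends by metis
  have xV: "x \<in> V" using assms joined_ends by metis
  have "gdist V E u x \<le> gdist V E u (last ys) + 1" by (rule gdist_edge[OF J e yV xV])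
  moreover have "gdist V E u (last ys) + 1 \<le> gdist V E u x"
    using gdist_le[OF w] xs(2) ys ne by (cases ys) auto
  ultimately show thesis using that yV e J by simp
qed

lemma gdist_0_iff: "joined V E u x \<Longrightarrow> gdist V E u x = 0 \<longleftrightarrow> x = u"
  by (metis Suc_eq_plus1 gdist_predecessor gdist_self joined_ends nat.distinct(1))

lemma gdist_sym:
  assumes "joined V E a b"
  shows "gdist V E a b = gdist V E b a"
proof -
  have "gdist V E y x \<le> gdist V E x y" if J: "joined V E x y" for x y
  proof -
    obtain xs where xs: "is_walk V E xs x y" "length xs = gdist V E x y + 1" using gdist_walk[OF J] .
    show ?thesis using gdist_le[OF is_walk_rev[OF xs(1)]] xs(2) by simp
  qed
  from this[OF assms] this[OF joined_sym[OF assms]] show ?thesis by (rule antisym[rotated])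
qed

section \<open>Cycles as vertex lists\<close>

lemma cycle_edges_image:
  "cycle_edges vs = (\<lambda>i. {vs ! i, vs ! ((i + 1) mod length vs)}) ` {..<length vs}"
  by (auto simp: cycle_edges_def)

text \<open>Allows any vertex of a cycle to be placed at index 0, which \<open>cycleE\<close> uses
  throughout.\<close>

lemma cycle_edges_rotate: "cycle_edges (rotate n vs) = cycle_edges vs"
proof (induction n)
  case 0
  then show ?case by simp
next
  case (Suc n)
  have "cycle_edges (rotate1 ws) = cycle_edges ws" for ws :: "'a list"
  proof (cases "ws = []")
    case True
    then show ?thesis by simp
  next
    case False
    define l where "l = length ws"
    have l: "l > 0" using False by (simp add: l_def)
    let ?f = "\<lambda>i. {ws ! i, ws ! ((i + 1) mod l)}"
    have surj: "(\<lambda>i. (i + 1) mod l) ` {..<l} = {..<l}"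
    proof
      show "{..<l} \<subseteq> (\<lambda>i. (i + 1) mod l) ` {..<l}"
      proof
        fix j assume j: "j \<in> {..<l}"
        show "j \<in> (\<lambda>i. (i + 1) mod l) ` {..<l}"
        proof (cases j)
          case 0
          then show ?thesis using l by (intro image_eqI[of _ _ "l - 1"]) auto
        next
          case (Suc k)
          then show ?thesis using j by (intro image_eqI[of _ _ k]) auto
        qed
      qed
    qed (use l in auto)
    have "cycle_edges (rotate1 ws) = (\<lambda>i. ?f ((i + 1) mod l)) ` {..<l}"
      unfolding cycle_edges_image using l by (intro image_cong) (auto simp: nth_rotate1 l_def)
    also have "\<dots> = ?f ` ((\<lambda>i. (i + 1) mod l) ` {..<l})" by (simp add: image_image)
    also have "\<dots> = cycle_edges ws" unfolding surj by (auto simp: cycle_edges_def l_def)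
    finally show ?thesis .
  qed
  with Suc show ?case by simp
qed

text \<open>Separates the closing edge from the path along the list, so that cycles can be built
  from walks and cut open into them.\<close>

lemma cycle_edges_subset_iff:
  assumes "vs \<noteq> []"
  shows "cycle_edges vs \<subseteq> E \<longleftrightarrow>
    successively (\<lambda>a b. {a, b} \<in> E) vs \<and> {last vs, hd vs} \<in> E"
proof -
  have "{..<length vs} = {i. i + 1 < length vs} \<union> {length vs - 1}"
    using assms by (auto simp: neq_Nil_conv)
  then have "cycle_edges vs \<subseteq> E \<longleftrightarrow> (\<forall>i. i + 1 < length vs \<longrightarrow> {vs ! i, vs ! (i + 1)} \<in> E) \<and>
     {vs ! (length vs - 1), vs ! 0} \<in> E"
    using assms by (auto simp: cycle_edges_image)
  then show ?thesis using assms by (simp add: successively_conv_nth last_conv_nth hd_conv_nth)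
qed

lemma Union_cycle_edges:
  assumes "vs \<noteq> []"
  shows "\<Union> (cycle_edges vs) = set vs"
proof
  show "\<Union> (cycle_edges vs) \<subseteq> set vs" using assms by (auto simp: cycle_edges_def)
  show "set vs \<subseteq> \<Union> (cycle_edges vs)"
    unfolding cycle_edges_image by (auto simp: in_set_conv_nth)
qed

lemma card_cycle_edges:
  assumes "distinct vs" "length vs \<ge> 3"
  shows "card (cycle_edges vs) = length vs"
proof -
  define l where "l = length vs"
  have l: "l \<ge> 3" using assms by (simp add: l_def)
  have "inj_on (\<lambda>i. {vs ! i, vs ! ((i + 1) mod l)}) {..<l}"
  proof (rule inj_onI)
    fix i j
    assume ij: "i \<in> {..<l}" "j \<in> {..<l}"
      and eq: "{vs ! i, vs ! ((i + 1) mod l)} = {vs ! j, vs ! ((j + 1) mod l)}"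
    have "vs ! a = vs ! b \<longleftrightarrow> a = b" if "a < l" "b < l" for a b
      using that assms(1) by (simp add: nth_eq_iff_index_eq l_def)
    \<comment> \<open>Two different indices giving the same edge would each be the cyclic successor
      of the other, which is impossible for \<open>l\<close> at least 3.\<close>
    then have "i = j \<or> (i = (j + 1) mod l \<and> j = (i + 1) mod l)"
      using eq ij l by (auto simp: doubleton_eq_iff)
    then show "i = j"
      using ij l by (auto simp: mod_Suc split: if_splits)
  qed
  then show ?thesis by (simp add: cycle_edges_image card_image l_def)
qed

lemma cycle_edges_at_hd:
  assumes "distinct vs" "length vs \<ge> 3"
  shows "{e \<in> cycle_edges vs. vs ! 0 \<in> e} = {{vs ! 0, vs ! 1}, {vs ! 0, vs ! (length vs - 1)}}"
proof -
  define l where "l = length vs"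
  have l: "l \<ge> 3" using assms by (simp add: l_def)
  have nth: "vs ! a = vs ! b \<longleftrightarrow> a = b" if "a < l" "b < l" for a b
    using that assms(1) by (simp add: nth_eq_iff_index_eq l_def)
  have zero: "(0 = i \<or> 0 = (i + 1) mod l) \<longleftrightarrow> i = 0 \<or> i = l - 1" if "i < l" for i
    using that l by (auto simp: mod_Suc)
  have "{e \<in> cycle_edges vs. vs ! 0 \<in> e} =
      (\<lambda>i. {vs ! i, vs ! ((i + 1) mod l)}) ` {i. i < l \<and> (0 = i \<or> 0 = (i + 1) mod l)}"
  proof -
    have "vs ! 0 \<in> {vs ! i, vs ! ((i + 1) mod l)} \<longleftrightarrow> 0 = i \<or> 0 = (i + 1) mod l" if "i < l" for i
      using that l nth[of 0 i] nth[of 0 "(i + 1) mod l"] by simp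
    then show ?thesis unfolding cycle_edges_image l_def[symmetric] by blast
  qed
  moreover have "{i. i < l \<and> (0 = i \<or> 0 = (i + 1) mod l)} = {0, l - 1}"
  proof -
    have "i < l \<and> (0 = i \<or> 0 = (i + 1) mod l) \<longleftrightarrow> i = 0 \<or> i = l - 1" for i
      using zero[of i] l by auto
    then show ?thesis by blast
  qed
  moreover have "Suc (length vs - Suc 0) = length vs" using l by (simp add: l_def)
  ultimately show ?thesis
    using l by (simp add: l_def insert_commute[of "vs ! (length vs - Suc 0)" "vs ! 0"])
qed

section \<open>Cycles of a bridgeless cactus: edge partition and separation\<close>

locale bridgeless_cactus =
  fixes V :: "'a set" and E :: "'a set set"
  assumes nontrivial: "nontrivial_cactus V E" and card_V: "card V \<ge> 2"
begin

abbreviation "cycles \<equiv> graph_cycles V E"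

definition cycle_deg :: "'a \<Rightarrow> nat" where
  "cycle_deg x = card {C \<in> cycles. x \<in> \<Union>C}"

lemma finite_V: "finite V"
  using nontrivial by (simp add: nontrivial_cactus_def cactus_def simple_graph_def)

lemma edgeE:
  assumes "e \<in> E"
  obtains a b where "e = {a, b}" "a \<noteq> b" "a \<in> V" "b \<in> V"
proof -
  have "e \<subseteq> V" "card e = 2"
    using assms nontrivial by (auto simp: nontrivial_cactus_def cactus_def simple_graph_def)
  then show thesis using that by (auto simp: card_2_iff)
qed

lemma finite_E: "finite E"
  by (rule finite_subset[of _ "Pow V"]) (use finite_V in \<open>auto elim: edgeE\<close>)

lemma connected: "u \<in> V \<Longrightarrow> v \<in> V \<Longrightarrow> joined V E u v"
  using nontrivial by (simp add: nontrivial_cactus_def cactus_def connected_graph_def)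

lemma cycle_subset_E: "C \<in> cycles \<Longrightarrow> C \<subseteq> E"
  by (auto simp: graph_cycles_def)

lemma finite_cycles: "finite cycles"
  by (rule finite_subset[of _ "Pow E"]) (use finite_E cycle_subset_E in auto)

lemma cycle_vertices: "C \<in> cycles \<Longrightarrow> \<Union>C \<subseteq> V"
  using cycle_subset_E by (blast elim: edgeE)

lemma finite_cycle_vertices: "C \<in> cycles \<Longrightarrow> finite (\<Union>C)"
  using cycle_vertices finite_V finite_subset by metis

lemma cycleE:
  assumes "C \<in> cycles" "x \<in> \<Union>C"
  obtains vs where "distinct vs" "length vs \<ge> 3" "cycle_edges vs = C" "set vs = \<Union>C" "vs ! 0 = x"
proof -
  obtain ws where ws: "distinct ws" "length ws \<ge> 3" "C = cycle_edges ws"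
    using assms(1) by (auto simp: graph_cycles_def)
  have ne: "ws \<noteq> []" using ws(2) by auto
  then obtain i where i: "i < length ws" "ws ! i = x"
    using assms(2) Union_cycle_edges[of ws] ws(3) by (auto simp: in_set_conv_nth)
  show thesis
    by (rule that[of "rotate i ws"])
      (use ws i ne in \<open>auto simp: cycle_edges_rotate nth_rotate Union_cycle_edges\<close>)
qed

lemma cycleI:
  assumes "distinct vs" "length vs \<ge> 3" "set vs \<subseteq> V"
    and "successively (\<lambda>a b. {a, b} \<in> E) vs" "{last vs, hd vs} \<in> E"
  shows "cycle_edges vs \<in> cycles"
proof -
  have "vs \<noteq> []" using assms(2) by auto
  then have "cycle_edges vs \<subseteq> E" using assms by (simp add: cycle_edges_subset_iff)
  then show ?thesis using assms by (auto simp: graph_cycles_def)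
qed

lemma cycle_nonempty: "C \<in> cycles \<Longrightarrow> \<exists>x. x \<in> \<Union>C"
proof -
  assume "C \<in> cycles"
  then obtain vs where "C = cycle_edges vs" "length vs \<ge> 3" by (auto simp: graph_cycles_def)
  moreover from this(2) have "vs \<noteq> []" by auto
  ultimately have "\<Union>C = set vs" "hd vs \<in> set vs" by (simp_all add: Union_cycle_edges)
  then show ?thesis by blast
qed

lemma card_cycle:
  assumes "C \<in> cycles"
  shows "card (\<Union>C) = card C" "card C \<ge> 3"
proof -
  obtain x where "x \<in> \<Union>C" using cycle_nonempty[OF assms] by blast
  then obtain vs where vs: "distinct vs" "length vs \<ge> 3" "cycle_edges vs = C" "set vs = \<Union>C"
    using cycleE[OF assms] by metis
  show "card (\<Union>C) = card C" "card C \<ge> 3"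
    using card_cycle_edges[OF vs(1,2)] vs distinct_card[OF vs(1)] by auto
qed

lemma cycle_eqI:
  assumes "C1 \<in> cycles" "C2 \<in> cycles" "a \<in> \<Union>C1" "b \<in> \<Union>C1" "a \<in> \<Union>C2" "b \<in> \<Union>C2" "a \<noteq> b"
  shows "C1 = C2"
proof (rule ccontr)
  assume "C1 \<noteq> C2"
  then have "card (\<Union>C1 \<inter> \<Union>C2) \<le> 1"
    using assms(1,2) nontrivial by (simp add: nontrivial_cactus_def cactus_def)
  moreover have "card {a, b} \<le> card (\<Union>C1 \<inter> \<Union>C2)"
    using assms finite_cycle_vertices by (intro card_mono) auto
  ultimately show False using assms(7) by simp
qed

lemma edge_cycle_unique:
  assumes "C1 \<in> cycles" "C2 \<in> cycles" "e \<in> C1" "e \<in> C2"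
  shows "C1 = C2"
proof -
  obtain a b where "e = {a, b}" "a \<noteq> b" using assms cycle_subset_E edgeE by blast
  then show ?thesis using assms by (intro cycle_eqI[of C1 C2 a b]) auto
qed

text \<open>As \<open>e\<close> is not a bridge, its ends are still joined after its removal; a walk
  without repetitions between them is closed up by \<open>e\<close>.\<close>

lemma edge_in_cycle:
  assumes "e \<in> E"
  obtains C where "C \<in> cycles" "e \<in> C"
proof -
  obtain a b where e: "e = {a, b}" "a \<noteq> b" "a \<in> V" "b \<in> V" using edgeE[OF assms] .
  have "joined V (E - {e}) a b"
    using nontrivial assms e by (auto simp: nontrivial_cactus_def is_bridge_def)
  then obtain xs where xs: "is_walk V (E - {e}) xs a b" "distinct xs"
    using joined_distinct_walk by metis
  then have ne: "xs \<noteq> []" and hl: "hd xs = a" "last xs = b" and V: "set xs \<subseteq> V"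
    and s: "successively (\<lambda>a b. {a, b} \<in> E - {e}) xs"
    by (auto simp: is_walk_successively)
  \<comment> \<open>Length 1 would make the two ends equal, and length 2 would make the walk use
    \<open>e\<close> itself.\<close>
  have "length xs \<noteq> 1" using hl e(2) by (auto simp: length_Suc_conv)
  moreover have "length xs \<noteq> 2"
    using hl s e(1) by (auto simp: numeral_2_eq_2 length_Suc_conv)
  moreover have "length xs \<noteq> 0" using ne by simp
  ultimately have l: "length xs \<ge> 3" by linarith
  have "cycle_edges xs \<in> cycles"
    using xs(2) l V s hl assms e(1)
    by (intro cycleI successively_mono[OF s]) (auto simp: insert_commute)
  moreover have "e \<in> cycle_edges xs"
    using cycle_edges_subset_iff[OF ne, of "cycle_edges xs"] hl e(1) by (simp add: insert_commute)
  ultimately show thesis by (rule that)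
qed

lemma E_eq_Union_cycles: "E = \<Union>cycles"
proof
  show "E \<subseteq> \<Union>cycles" 
  proof
    fix e assume "e \<in> E"
    then obtain C where "C \<in> cycles" "e \<in> C" by (rule edge_in_cycle)
    then show "e \<in> \<Union>cycles" by blast
  qed
  show "\<Union>cycles \<subseteq> E" using cycle_subset_E by blast
qed

lemma cycle_neighbour:
  assumes "C \<in> cycles" "x \<in> \<Union>C"
  obtains y where "{x, y} \<in> C" "y \<in> \<Union>C" "y \<noteq> x"
proof -
  obtain vs where vs: "distinct vs" "length vs \<ge> 3" "cycle_edges vs = C" "vs ! 0 = x"
    using cycleE[OF assms] by metis
  then have "{x, vs ! 1} \<in> C" using cycle_edges_at_hd[of vs] by blast
  moreover have "vs ! 1 \<noteq> vs ! 0" using vs by (subst nth_eq_iff_index_eq) auto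
  ultimately show thesis using vs by (intro that[of "vs ! 1"]) auto
qed

lemma cycle_joined:
  assumes "C \<in> cycles" "a \<in> \<Union>C" "b \<in> \<Union>C"
  shows "joined (\<Union>C) C a b"
proof -
  obtain vs where vs: "length vs \<ge> 3" "cycle_edges vs = C" "set vs = \<Union>C"
    using cycleE[OF assms(1,2)] by metis
  then have "vs \<noteq> []" by auto
  then have "successively (\<lambda>a b. {a, b} \<in> C) vs"
    using vs cycle_edges_subset_iff by blast
  then show ?thesis using assms vs(3) by (intro joined_along_list[of C vs]) auto
qed

text \<open>With \<open>x\<close> rotated to the front, the tail of the list is a path through all
  remaining vertices.\<close>

lemma cycle_minus_vertex_joined:
  assumes "C \<in> cycles" "x \<in> \<Union>C" "a \<in> \<Union>C - {x}" "b \<in> \<Union>C - {x}"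
  shows "joined (\<Union>C - {x}) {e \<in> C. x \<notin> e} a b"
proof -
  obtain vs where vs: "distinct vs" "length vs \<ge> 3" "cycle_edges vs = C" "set vs = \<Union>C" "vs ! 0 = x"
    using cycleE[OF assms(1,2)] .
  then obtain ys where ys: "vs = x # ys" by (cases vs) auto
  have "successively (\<lambda>a b. {a, b} \<in> C) vs"
    using vs(3) cycle_edges_subset_iff[of vs C] ys by simp
  then have "successively (\<lambda>a b. {a, b} \<in> C) ys" by (cases ys) (simp_all add: ys)
  then have "successively (\<lambda>a b. {a, b} \<in> {e \<in> C. x \<notin> e}) ys"
    by (rule successively_mono) (use vs(1) ys in auto)
  moreover have "set ys = \<Union>C - {x}" using vs(1,4) ys by auto
  ultimately show ?thesis using assms by (intro joined_along_list[of _ ys]) auto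
qed

text \<open>A walk between the two cycles that avoids their common vertex \<open>x\<close> would close up to a third
  cycle through \<open>x\<close> meeting each of them in a second vertex.\<close>

lemma cycles_separated:
  assumes C: "C1 \<in> cycles" "C2 \<in> cycles" "C1 \<noteq> C2"
    and x: "x \<in> \<Union>C1" "x \<in> \<Union>C2" and a: "a \<in> \<Union>C1 - {x}" and b: "b \<in> \<Union>C2 - {x}"
  shows "\<not> joined (V - {x}) {e \<in> E. x \<notin> e} a b"
proof
  assume J: "joined (V - {x}) {e \<in> E. x \<notin> e} a b"
  obtain y1 where y1: "{x, y1} \<in> C1" "y1 \<in> \<Union>C1" "y1 \<noteq> x" using cycle_neighbour[OF C(1) x(1)] .
  obtain y2 where y2: "{x, y2} \<in> C2" "y2 \<in> \<Union>C2" "y2 \<noteq> x" using cycle_neighbour[OF C(2) x(2)] .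
  have j1: "joined (V - {x}) {e \<in> E. x \<notin> e} y1 a"
    by (rule joined_mono[OF cycle_minus_vertex_joined[OF C(1) x(1)]])
      (use y1 a cycle_vertices[OF C(1)] cycle_subset_E[OF C(1)] in auto)
  have j2: "joined (V - {x}) {e \<in> E. x \<notin> e} b y2"
    by (rule joined_mono[OF cycle_minus_vertex_joined[OF C(2) x(2)]])
      (use y2 b cycle_vertices[OF C(2)] cycle_subset_E[OF C(2)] in auto)
  have "joined (V - {x}) {e \<in> E. x \<notin> e} y1 y2"
    by (rule joined_trans[OF j1 joined_trans[OF J j2]])
  then obtain ys where ys: "is_walk (V - {x}) {e \<in> E. x \<notin> e} ys y1 y2" "distinct ys"
    using joined_distinct_walk by metis
  have ne: "y1 \<noteq> y2" using cycle_eqI[OF C(1,2) x(1) y1(2) x(2)] y1(3) y2(2) C(3) by blast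
  have ends: "ys \<noteq> []" "hd ys = y1" "last ys = y2" "set ys \<subseteq> V - {x}"
    using ys(1) by (auto simp: is_walk_def)
  \<comment> \<open>Two distinct ends give \<open>ys\<close> at least two entries, so
    \<open>x # ys\<close> has the three vertices that a cycle needs.\<close>
  then have len: "length ys \<ge> 2" using ne
    by (metis Suc_1 Suc_leI hd_conv_nth last_conv_nth length_greater_0_conv less_one linorder_neqE_nat
        One_nat_def diff_Suc_1 not_less_eq)
  have "successively (\<lambda>a b. {a, b} \<in> {e \<in> E. x \<notin> e}) ys"
    using ys(1) by (simp add: is_walk_successively)
  then have s: "successively (\<lambda>a b. {a, b} \<in> E) ys" by (rule successively_mono) simp
  have E: "{x, y1} \<in> E" "{y2, x} \<in> E" "x \<in> V"
    using y1(1) y2(1) cycle_subset_E[OF C(1)] cycle_subset_E[OF C(2)] cycle_vertices[OF C(1)] x(1)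
    unfolding insert_commute[of y2] by blast+
  have D: "cycle_edges (x # ys) \<in> cycles"
    using ys(2) len ends s E by (intro cycleI) (auto simp: successively_Cons)
  have U: "\<Union>(cycle_edges (x # ys)) = insert x (set ys)" by (simp add: Union_cycle_edges)
  have "y1 \<in> set ys" "y2 \<in> set ys" using ends by auto
  then have "cycle_edges (x # ys) = C1" "cycle_edges (x # ys) = C2"
    using cycle_eqI[OF D C(1) _ _ x(1) y1(2)] cycle_eqI[OF D C(2) _ _ x(2) y2(2)] y1(3) y2(3)
    unfolding U by blast+
  then show False using C(3) by simp
qed

lemma artic_if_two_cycles:
  assumes "C1 \<in> cycles" "C2 \<in> cycles" "C1 \<noteq> C2" "x \<in> \<Union>C1" "x \<in> \<Union>C2"
  shows "is_artic V E x"
proof -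
  obtain a where a: "a \<in> \<Union>C1 - {x}" by (rule cycle_neighbour[OF assms(1,4)]) simp
  obtain b where b: "b \<in> \<Union>C2 - {x}" by (rule cycle_neighbour[OF assms(2,5)]) simp
  have "a \<in> V - {x}" "b \<in> V - {x}" "x \<in> V"
    using a b assms cycle_vertices[of C1] cycle_vertices[of C2] by auto
  then show ?thesis
    using cycles_separated[OF assms a b] unfolding is_artic_def by blast
qed

section \<open>Cycle degrees, vertex degrees and the number of edges\<close>

lemma cycle_deg_geI:
  assumes "C1 \<in> cycles" "C2 \<in> cycles" "C1 \<noteq> C2" "x \<in> \<Union>C1" "x \<in> \<Union>C2"
  shows "cycle_deg x \<ge> 2"
proof -
  have "card {C1, C2} \<le> cycle_deg x"
    unfolding cycle_deg_def by (rule card_mono) (use assms finite_cycles in auto)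
  then show ?thesis using assms(3) by simp
qed

lemma artic_if_cycle_deg: "cycle_deg x \<ge> 2 \<Longrightarrow> is_artic V E x"
proof -
  assume "cycle_deg x \<ge> 2"
  then have "\<not> card {C \<in> cycles. x \<in> \<Union>C} \<le> Suc 0" by (simp add: cycle_deg_def)
  moreover have "finite {C \<in> cycles. x \<in> \<Union>C}" using finite_cycles by simp
  ultimately obtain C1 C2 where "C1 \<in> cycles" "C2 \<in> cycles" "C1 \<noteq> C2" "x \<in> \<Union>C1" "x \<in> \<Union>C2"
    unfolding card_le_Suc0_iff_eq[OF \<open>finite _\<close>] by blast
  then show ?thesis by (rule artic_if_two_cycles)
qed

text \<open>The cycles through \<open>x\<close> share no edge, and each has exactly two edges at
  \<open>x\<close>.\<close>

lemma degree_eq: "degree E x = 2 * cycle_deg x"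
proof -
  let ?K = "{C \<in> cycles. x \<in> \<Union>C}"
  have "{e \<in> E. x \<in> e} = (\<Union>C\<in>?K. {e \<in> C. x \<in> e})"
    by (subst E_eq_Union_cycles) blast
  then have "degree E x = card (\<Union>C\<in>?K. {e \<in> C. x \<in> e})" by (simp add: degree_def)
  also have "\<dots> = (\<Sum>C\<in>?K. card {e \<in> C. x \<in> e})"
  proof (rule card_UN_disjoint)
    show "\<forall>C\<in>?K. finite {e \<in> C. x \<in> e}"
      using cycle_subset_E finite_E finite_subset by fastforce
    show "\<forall>C\<in>?K. \<forall>C'\<in>?K. C \<noteq> C' \<longrightarrow> {e \<in> C. x \<in> e} \<inter> {e \<in> C'. x \<in> e} = {}"
      using edge_cycle_unique by blast
  qed (use finite_cycles in simp)
  also have "\<dots> = (\<Sum>C\<in>?K. 2)"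
  proof (rule sum.cong)
    fix C assume C: "C \<in> ?K"
    then obtain vs where vs: "distinct vs" "length vs \<ge> 3" "cycle_edges vs = C" "vs ! 0 = x"
      using cycleE by (metis (no_types, lifting) mem_Collect_eq)
    have "vs ! a = vs ! b \<longleftrightarrow> a = b" if "a < length vs" "b < length vs" for a b
      using that vs(1) by (simp add: nth_eq_iff_index_eq)
    from this[of 1 "length vs - 1"] this[of 1 0]
    have "{vs ! 0, vs ! 1} \<noteq> {vs ! 0, vs ! (length vs - 1)}"
      using vs(2) by (auto simp: doubleton_eq_iff)
    then show "card {e \<in> C. x \<in> e} = 2"
      using cycle_edges_at_hd[OF vs(1,2)] vs by simp
  qed simp
  finally show ?thesis by (simp add: cycle_deg_def)
qed

lemma card_E: "card E = (\<Sum>C\<in>cycles. card C)"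
proof -
  have "card E = card (\<Union>C\<in>cycles. C)" using E_eq_Union_cycles by simp
  also have "\<dots> = (\<Sum>C\<in>cycles. card C)"
  proof (rule card_UN_disjoint)
    show "\<forall>C\<in>cycles. finite C" using cycle_subset_E finite_E finite_subset by blast
    show "\<forall>C\<in>cycles. \<forall>C'\<in>cycles. C \<noteq> C' \<longrightarrow> C \<inter> C' = {}" using edge_cycle_unique by blast
  qed (rule finite_cycles)
  finally show ?thesis .
qed

text \<open>Double counting of incidences between vertices and cycles, using that a cycle has as
  many vertices as edges.\<close>

lemma sum_cycle_deg: "(\<Sum>x\<in>V. cycle_deg x) = card E"
proof -
  have "(\<Sum>x\<in>V. cycle_deg x) = (\<Sum>x\<in>V. \<Sum>C | C \<in> cycles \<and> x \<in> \<Union>C. 1)"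
    by (simp add: cycle_deg_def)
  also have "\<dots> = (\<Sum>C\<in>cycles. \<Sum>x | x \<in> V \<and> x \<in> \<Union>C. 1)"
    by (rule sum.swap_restrict[OF finite_V finite_cycles])
  also have "\<dots> = (\<Sum>C\<in>cycles. card C)"
  proof (rule sum.cong)
    fix C assume C: "C \<in> cycles"
    then have "{x. x \<in> V \<and> x \<in> \<Union>C} = \<Union>C" using cycle_vertices by blast
    then show "(\<Sum>x | x \<in> V \<and> x \<in> \<Union>C. 1) = card C" using card_cycle[OF C] by simp
  qed simp
  finally show ?thesis by (simp add: card_E)
qed

text \<open>\<open>card_V\<close> excludes the one-vertex graph, whose vertex lies on no cycle and
  for which the first bound fails because R = d = 0. Given a second vertex, the last edge of a
  shortest walk from it to \<open>x\<close> lies on a cycle.\<close>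

lemma cycle_deg_pos:
  assumes "x \<in> V"
  shows "cycle_deg x \<ge> 1"
proof -
  have "V \<noteq> {x}" using card_V by auto
  then obtain y where y: "y \<in> V" "y \<noteq> x" using assms by blast
  obtain z where "{z, x} \<in> E" using gdist_predecessor[OF connected[OF y(1) assms]] y by metis
  then obtain C where "C \<in> cycles" "{z, x} \<in> C" using edge_in_cycle by blast
  then have "C \<in> {C \<in> cycles. x \<in> \<Union>C}" by auto
  then have "{C \<in> cycles. x \<in> \<Union>C} \<noteq> {}" by blast
  then show ?thesis using finite_cycles by (simp add: cycle_deg_def Suc_leI card_gt_0_iff)
qed

section \<open>The Randic index in terms of cycle degrees\<close>

text \<open>The two sides differ by \<open>(t - f a) * (t - f b)\<close> with
  \<open>t = 1 / sqrt 2\<close>. Degrees are at least 2, so both factors are nonnegative, and a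
  factor vanishes at an end of degree 2.\<close>

lemma randic_edge:
  assumes "{a, b} \<in> E" "a \<noteq> b"
  defines "f \<equiv> \<lambda>v. 1 / sqrt (real (degree E v))"
  shows "1 / sqrt (\<Prod>v\<in>{a, b}. real (degree E v)) \<ge> (\<Sum>v\<in>{a, b}. f v / sqrt 2) - 1 / 2"
    and "cycle_deg a = 1 \<or> cycle_deg b = 1 \<Longrightarrow>
      1 / sqrt (\<Prod>v\<in>{a, b}. real (degree E v)) = (\<Sum>v\<in>{a, b}. f v / sqrt 2) - 1 / 2"
proof -
  define t where "t = 1 / sqrt (2 :: real)"
  have tt: "t * t = 1 / 2" by (simp add: t_def)
  have V: "a \<in> V" "b \<in> V" using edgeE[OF assms(1)] by (metis insertCI insertE singletonD doubleton_eq_iff)+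
  have le: "f v \<le> t" if "v \<in> V" for v
    using cycle_deg_pos[OF that] by (simp add: f_def t_def degree_eq frac_le)
  have eq: "f v = t" if "cycle_deg v = 1" for v using that by (simp add: f_def t_def degree_eq)
  have prod: "1 / sqrt (\<Prod>v\<in>{a, b}. real (degree E v)) = f a * f b"
    using assms(2) by (simp add: f_def real_sqrt_mult)
  have sum: "(\<Sum>v\<in>{a, b}. f v / sqrt 2) = f a * t + f b * t"
    using assms(2) by (simp add: t_def)
  have id: "f a * f b - (f a * t + f b * t - 1 / 2) = (t - f a) * (t - f b)"
    using tt by (simp add: algebra_simps)
  have "(t - f a) * (t - f b) \<ge> 0" using le V by simp
  then show "1 / sqrt (\<Prod>v\<in>{a, b}. real (degree E v)) \<ge> (\<Sum>v\<in>{a, b}. f v / sqrt 2) - 1 / 2"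
    unfolding prod sum using id by linarith
  assume "cycle_deg a = 1 \<or> cycle_deg b = 1"
  then have "(t - f a) * (t - f b) = 0" using eq by auto
  then show "1 / sqrt (\<Prod>v\<in>{a, b}. real (degree E v)) = (\<Sum>v\<in>{a, b}. f v / sqrt 2) - 1 / 2"
    unfolding prod sum using id by linarith
qed

text \<open>After exchanging the sums, a vertex on s cycles is counted on 2 s edges, each time with
  weight 1 / (2 sqrt s), for a total of sqrt s.\<close>

lemma sum_edge_endpoints:
  "(\<Sum>e\<in>E. (\<Sum>v\<in>e. 1 / sqrt (real (degree E v)) / sqrt 2) - 1 / 2)
     = (\<Sum>v\<in>V. sqrt (real (cycle_deg v))) - real (card E) / 2"
proof -
  let ?g = "\<lambda>v. 1 / sqrt (real (degree E v)) / sqrt 2"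
  have "(\<Sum>e\<in>E. \<Sum>v\<in>e. ?g v) = (\<Sum>e\<in>E. \<Sum>v | v \<in> V \<and> v \<in> e. ?g v)"
  proof (rule sum.cong)
    fix e assume "e \<in> E"
    then have "{v. v \<in> V \<and> v \<in> e} = e" using edgeE by blast
    then show "(\<Sum>v\<in>e. ?g v) = (\<Sum>v | v \<in> V \<and> v \<in> e. ?g v)" by simp
  qed simp
  also have "\<dots> = (\<Sum>v\<in>V. \<Sum>e | e \<in> E \<and> v \<in> e. ?g v)"
    by (rule sum.swap_restrict[OF finite_E finite_V])
  also have "\<dots> = (\<Sum>v\<in>V. sqrt (real (cycle_deg v)))"
  proof (rule sum.cong)
    fix v assume "v \<in> V"
    then have pos: "real (cycle_deg v) > 0" using cycle_deg_pos by fastforce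
    have "(\<Sum>e | e \<in> E \<and> v \<in> e. ?g v) = real (degree E v) * ?g v"
      by (simp add: degree_def)
    also have "\<dots> = real (cycle_deg v) / sqrt (real (cycle_deg v))"
      using pos by (simp add: degree_eq real_sqrt_mult field_simps)
    also have "\<dots> = sqrt (real (cycle_deg v))" using pos by (simp add: real_div_sqrt)
    finally show "(\<Sum>e | e \<in> E \<and> v \<in> e. ?g v) = sqrt (real (cycle_deg v))" .
  qed simp
  finally show ?thesis by (simp add: sum_subtractf)
qed

lemma randic_ge: "randic E \<ge> (\<Sum>v\<in>V. sqrt (real (cycle_deg v))) - real (card E) / 2"
  unfolding sum_edge_endpoints[symmetric] randic_def
  by (rule sum_mono) (metis edgeE randic_edge(1))

lemma randic_eq:
  assumes "\<And>a b. {a, b} \<in> E \<Longrightarrow> a \<noteq> b \<Longrightarrow> cycle_deg a = 1 \<or> cycle_deg b = 1"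
  shows "randic E = (\<Sum>v\<in>V. sqrt (real (cycle_deg v))) - real (card E) / 2"
  unfolding sum_edge_endpoints[symmetric] randic_def
proof (rule sum.cong)
  fix e assume e: "e \<in> E"
  then obtain a b where "e = {a, b}" "a \<noteq> b" using edgeE by metis
  then show "1 / sqrt (\<Prod>v\<in>e. real (degree E v)) =
      (\<Sum>v\<in>e. 1 / sqrt (real (degree E v)) / sqrt 2) - 1 / 2"
    using randic_edge(2)[of a b] assms[of a b] e by metis
qed simp

end

text \<open>The vertex at index \<open>i\<close> is reached from index 0 by \<open>i\<close> steps
  forwards or by \<open>length vs - i\<close> steps backwards.\<close>

lemma (in bridgeless_cactus) gdist_along_cycle:
  assumes "cycle_edges vs \<in> cycles" "b \<in> V" "i < length vs"
  shows "gdist V E b (vs ! i) \<le> gdist V E b (vs ! 0) + min i (length vs - i)"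
proof -
  define l where "l = length vs"
  have l: "0 < l" "vs \<noteq> []" using assms(3) by (auto simp: l_def)
  have "set vs \<subseteq> V"
    using cycle_vertices[OF assms(1)] Union_cycle_edges[of vs] l by (simp add: l_def)
  then have V: "vs ! j \<in> V" if "j < l" for j
    using that by (simp add: l_def subset_code(1))
  have e: "{vs ! j, vs ! ((j + 1) mod l)} \<in> E" if "j < l" for j
    using that cycle_subset_E[OF assms(1)] by (auto simp: cycle_edges_image l_def)
  have step: "gdist V E b y \<le> gdist V E b x + 1" if "{x, y} \<in> E" "x \<in> V" "y \<in> V" for x y
    using gdist_edge[OF connected[OF assms(2) that(2)] that] .
  have up: "gdist V E b (vs ! j) \<le> gdist V E b (vs ! 0) + j" if "j < l" for j
    using that
  proof (induction j)
    case (Suc j)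
    have "{vs ! j, vs ! Suc j} \<in> E" using e[of j] Suc.prems by simp
    from step[OF this V V] Suc show ?case by simp
  qed simp
  \<comment> \<open>Here \<open>j\<close> counts backward steps. The first one crosses the closing
    edge of the list, hence the separate case \<open>j = 0\<close> in the induction step.\<close>
  have down: "gdist V E b (vs ! (l - j)) \<le> gdist V E b (vs ! 0) + j" if "0 < j" "j \<le> l" for j
    using that
  proof (induction j)
    case (Suc j)
    have *: "{vs ! ((l - Suc j + 1) mod l), vs ! (l - Suc j)} \<in> E"
      using e[of "l - Suc j"] l by (simp add: insert_commute)
    show ?case
    proof (cases "j = 0")
      case True
      then have "(l - Suc j + 1) mod l = 0" using l by simp
      with * have "{vs ! 0, vs ! (l - Suc j)} \<in> E" by simp
      from step[OF this V V] show ?thesis using True l by simp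
    next
      case False
      then have "(l - Suc j + 1) mod l = l - j" using Suc.prems by (simp add: Suc_diff_Suc)
      with * have "{vs ! (l - j), vs ! (l - Suc j)} \<in> E" by simp
      from step[OF this V V] Suc.IH False Suc.prems show ?thesis by simp
    qed
  qed simp
  show ?thesis
    using up[of i] down[of "l - i"] assms(3) by (simp add: l_def min_def)
qed

section \<open>Rooting the cactus at a vertex\<close>

locale rooted_cactus = bridgeless_cactus +
  fixes u :: 'a
  assumes u_in_V: "u \<in> V"
begin

abbreviation D :: "'a \<Rightarrow> nat" where "D x \<equiv> gdist V E u x"

text \<open>Every nearest vertex would do; uniqueness is a consequence of \<open>D_root_less\<close>.\<close>

definition root_of :: "'a set set \<Rightarrow> 'a" where
  "root_of C = arg_min D (\<lambda>x. x \<in> \<Union>C)"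

lemma root_of_in: "C \<in> cycles \<Longrightarrow> root_of C \<in> \<Union>C"
  and D_root_le: "x \<in> \<Union>C \<Longrightarrow> D (root_of C) \<le> D x"
  using arg_min_nat_lemma[of "\<lambda>x. x \<in> \<Union>C" _ D] cycle_nonempty unfolding root_of_def by blast+

lemma D_eq_0_iff: "x \<in> V \<Longrightarrow> D x = 0 \<longleftrightarrow> x = u"
  using gdist_0_iff[OF connected[OF u_in_V]] .

text \<open>On a shortest walk from \<open>u\<close> to \<open>y\<close> every vertex before
  \<open>y\<close> is nearer to \<open>u\<close> than \<open>y\<close>, hence nearer than
  \<open>x\<close>, so the walk misses \<open>x\<close>.\<close>

lemma joined_avoiding:
  assumes "y \<in> V" "D y \<le> D x" "y \<noteq> x" "x \<noteq> u"
  shows "joined (V - {x}) {e \<in> E. x \<notin> e} u y"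
  using assms
proof (induction "D y" arbitrary: y rule: less_induct)
  case less
  show ?case
  proof (cases "y = u")
    case True
    then show ?thesis using less.prems by (simp add: joined_refl)
  next
    case False
    obtain z where z: "z \<in> V" "{z, y} \<in> E" "D y = D z + 1"
      using gdist_predecessor[OF connected[OF u_in_V less.prems(1)] False] by metis
    then have "z \<noteq> x" using less.prems by auto
    with less z have "joined (V - {x}) {e \<in> E. x \<notin> e} u z" by simp
    moreover have "joined (V - {x}) {e \<in> E. x \<notin> e} z y"
      using z \<open>z \<noteq> x\<close> less.prems by (intro joined_edge) auto
    ultimately show ?thesis by (rule joined_trans)
  qed
qed

text \<open>The roots of both cycles are at most as far from \<open>u\<close> as \<open>x\<close>
  and differ from \<open>x\<close>, so they are joined through \<open>u\<close> without meeting
  \<open>x\<close>. This contradicts \<open>cycles_separated\<close>.\<close>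

lemma parent_unique:
  assumes "C1 \<in> cycles" "C2 \<in> cycles" "x \<in> \<Union>C1" "x \<in> \<Union>C2" "root_of C1 \<noteq> x" "root_of C2 \<noteq> x"
  shows "C1 = C2"
proof (rule ccontr)
  assume ne: "C1 \<noteq> C2"
  have r: "root_of C1 \<in> \<Union>C1" "root_of C2 \<in> \<Union>C2" using root_of_in assms by auto
  then have rV: "root_of C1 \<in> V" "root_of C2 \<in> V"
    using cycle_vertices[OF assms(1)] cycle_vertices[OF assms(2)] by blast+
  have "x \<noteq> u"
    using D_root_le[OF assms(3)] D_eq_0_iff[OF rV(1)] assms(5) gdist_self[OF u_in_V] by auto
  then have "joined (V - {x}) {e \<in> E. x \<notin> e} u (root_of C1)"
    "joined (V - {x}) {e \<in> E. x \<notin> e} u (root_of C2)"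
    using joined_avoiding rV D_root_le assms by simp_all
  then have "joined (V - {x}) {e \<in> E. x \<notin> e} (root_of C1) (root_of C2)"
    by (rule joined_trans[OF joined_sym])
  then show False using cycles_separated[OF assms(1,2) ne assms(3,4)] r assms(5,6) by blast
qed

text \<open>The cycle containing an edge that descends towards \<open>u\<close> is a parent cycle of
  its upper end, since the lower end is a nearer vertex on it.\<close>

lemma parent_of_predecessor:
  assumes "x \<in> V" "{y, x} \<in> C" "C \<in> cycles" "D x = D y + 1"
  shows "root_of C \<noteq> x" "D (root_of C) < D x"
proof -
  have "y \<in> \<Union>C" using assms(2) by blast
  from D_root_le[OF this] show "root_of C \<noteq> x" "D (root_of C) < D x" using assms(4) by auto
qed

lemma parentE:
  assumes "x \<in> V" "x \<noteq> u"
  obtains C where "C \<in> cycles" "x \<in> \<Union>C" "root_of C \<noteq> x" "D (root_of C) < D x"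
proof -
  obtain y where y: "{y, x} \<in> E" "D x = D y + 1"
    using gdist_predecessor[OF connected[OF u_in_V assms(1)] assms(2)] by metis
  obtain C where C: "C \<in> cycles" "{y, x} \<in> C" using edge_in_cycle[OF y(1)] .
  show thesis
    using parent_of_predecessor[OF assms(1) C(2,1) y(2)] C by (intro that[of C]) auto
qed

text \<open>By \<open>parent_unique\<close>, \<open>C\<close> is the cycle that
  \<open>parentE\<close> finds for \<open>x\<close>, and there the inequality is strict. Hence the
  nearest vertex of a cycle is unique.\<close>

lemma D_root_less:
  assumes "C \<in> cycles" "x \<in> \<Union>C" "root_of C \<noteq> x"
  shows "D (root_of C) < D x" "x \<noteq> u"
proof -
  have x: "x \<in> V" "root_of C \<in> V" using assms(1,2) root_of_in cycle_vertices by blast+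
  show "x \<noteq> u"
    using D_root_le[OF assms(2)] D_eq_0_iff[OF x(2)] assms(3) gdist_self[OF u_in_V] by auto
  then obtain C' where C': "C' \<in> cycles" "x \<in> \<Union>C'" "root_of C' \<noteq> x" "D (root_of C') < D x"
    using parentE[OF x(1)] by metis
  then show "D (root_of C) < D x" using parent_unique[OF assms(1) C'(1) assms(2) C'(2)] assms(3) by simp
qed

text \<open>Each vertex other than \<open>u\<close> is a non-root vertex of exactly one cycle.\<close>

lemma card_E_eq: "card E + 1 = card V + card cycles"
proof -
  have V: "V - {u} = (\<Union>C\<in>cycles. \<Union>C - {root_of C})"
  proof
    show "V - {u} \<subseteq> (\<Union>C\<in>cycles. \<Union>C - {root_of C})"
    proof
      fix x assume x: "x \<in> V - {u}"
      then have "x \<in> V" "x \<noteq> u" by auto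
      then obtain C where "C \<in> cycles" "x \<in> \<Union>C" "root_of C \<noteq> x" by (rule parentE)
      then show "x \<in> (\<Union>C\<in>cycles. \<Union>C - {root_of C})" by blast
    qed
    show "(\<Union>C\<in>cycles. \<Union>C - {root_of C}) \<subseteq> V - {u}"
    proof
      fix x assume "x \<in> (\<Union>C\<in>cycles. \<Union>C - {root_of C})"
      then obtain C where C: "C \<in> cycles" "x \<in> \<Union>C" "root_of C \<noteq> x" by blast
      then show "x \<in> V - {u}" using D_root_less(2)[OF C] cycle_vertices[OF C(1)] by blast
    qed
  qed
  have "card (V - {u}) = (\<Sum>C\<in>cycles. card (\<Union>C - {root_of C}))"
    unfolding V
  proof (rule card_UN_disjoint)
    show "\<forall>C\<in>cycles. finite (\<Union>C - {root_of C})" using finite_cycle_vertices by blast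
    show "\<forall>C\<in>cycles. \<forall>C'\<in>cycles. C \<noteq> C' \<longrightarrow> (\<Union>C - {root_of C}) \<inter> (\<Union>C' - {root_of C'}) = {}"
    proof (intro ballI impI, rule ccontr)
      fix C C' assume C: "C \<in> cycles" "C' \<in> cycles" "C \<noteq> C'"
        and "(\<Union>C - {root_of C}) \<inter> (\<Union>C' - {root_of C'}) \<noteq> {}"
      then obtain x where "x \<in> \<Union>C" "x \<in> \<Union>C'" "root_of C \<noteq> x" "root_of C' \<noteq> x" by blast
      then show False using parent_unique[OF C(1,2)] C(3) by blast
    qed
  qed (rule finite_cycles)
  then have "card (V - {u}) + card cycles = (\<Sum>C\<in>cycles. card (\<Union>C - {root_of C}) + 1)"
    by (simp only: sum.distrib card_eq_sum)
  also have "\<dots> = card E"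
    unfolding card_E
  proof (rule sum.cong)
    fix C assume C: "C \<in> cycles"
    then have "card (\<Union>C - {root_of C}) = card C - 1"
      using root_of_in[OF C] finite_cycle_vertices[OF C] card_cycle[OF C] by simp
    then show "card (\<Union>C - {root_of C}) + 1 = card C" using card_cycle[OF C] by simp
  qed simp
  finally show ?thesis using u_in_V finite_V card_V by (simp add: card_Diff_singleton)
qed

text \<open>The last edge of a shortest walk to a non-root vertex of \<open>C\<close> lies on a
  parent cycle of that vertex, hence in \<open>C\<close>. So shortest walks enter \<open>C\<close>
  at its root and then follow it.\<close>

lemma D_on_cycle:
  assumes "C \<in> cycles" "cycle_edges vs = C" "distinct vs" "length vs \<ge> 3" "vs ! 0 = root_of C"
    and "i < length vs"
  shows "D (vs ! i) = D (root_of C) + min i (length vs - i)"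
proof (rule antisym)
  show "D (vs ! i) \<le> D (root_of C) + min i (length vs - i)"
    using gdist_along_cycle[of vs u i] assms u_in_V by simp
  define l where "l = length vs"
  have l: "l \<ge> 3" using assms(4) by (simp add: l_def)
  have nth: "vs ! a = vs ! b \<longleftrightarrow> a = b" if "a < l" "b < l" for a b
    using that assms(3) by (simp add: nth_eq_iff_index_eq l_def)
  have "vs \<noteq> []" using assms(4) by auto
  then have "set vs = \<Union>C" using Union_cycle_edges[of vs] assms(2) by simp
  then have inC: "vs ! j \<in> \<Union>C" if "j < l" for j using that by (simp add: l_def flip: \<open>set vs = _\<close>)
  have "D (vs ! i) \<ge> D (root_of C) + min i (l - i)"
    using assms(6) unfolding l_def[symmetric]
  proof (induction "D (vs ! i)" arbitrary: i rule: less_induct)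
    case less
    show ?case
    proof (cases "i = 0")
      case True
      then show ?thesis using assms(5) by simp
    next
      case False
      let ?x = "vs ! i"
      have ne: "root_of C \<noteq> ?x" using nth[of 0 i] less.prems False l assms(5) by simp
      have xV: "?x \<in> V" using inC[OF less.prems] cycle_vertices[OF assms(1)] by blast
      have xu: "?x \<noteq> u" using D_root_less(2)[OF assms(1) inC[OF less.prems] ne] .
      obtain y where y: "{y, ?x} \<in> E" "D ?x = D y + 1"
        using gdist_predecessor[OF connected[OF u_in_V xV] xu] by metis
      obtain C' where C': "C' \<in> cycles" "{y, ?x} \<in> C'" using edge_in_cycle[OF y(1)] .
      have "C' = C"
        using parent_unique[OF C'(1) assms(1) _ inC[OF less.prems] _ ne]
          parent_of_predecessor(1)[OF xV C'(2,1) y(2)] C'(2) by blast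
      with C' assms(2) obtain j where j: "j < l" "{y, ?x} = {vs ! j, vs ! ((j + 1) mod l)}"
        by (auto simp: cycle_edges_image l_def)
      have yx: "y \<noteq> ?x" using y(2) by auto
      have "(j + 1) mod l < l" using l by simp
      then have "(i = j \<and> y = vs ! ((j + 1) mod l)) \<or> (i = (j + 1) mod l \<and> y = vs ! j)"
        using j yx nth[OF less.prems j(1)] nth[OF less.prems, of "(j + 1) mod l"]
        by (auto simp: doubleton_eq_iff)
      then obtain k where k: "k < l" "y = vs ! k" "i = (k + 1) mod l \<or> k = (i + 1) mod l"
        using j(1) \<open>(j + 1) mod l < l\<close> by metis
      \<comment> \<open>The predecessor is a cyclic neighbour of index \<open>i\<close>, and between
        neighbouring indices the cyclic distance to 0 changes by at most 1.\<close>
      have "min i (l - i) \<le> min k (l - k) + 1"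
        using k(1,3) less.prems l by (auto simp: mod_Suc min_def split: if_splits)
      moreover have "D (vs ! k) \<ge> D (root_of C) + min k (l - k)"
        using less.hyps[of k] y(2) k by simp
      ultimately show ?thesis using y(2) k(2) by simp
    qed
  qed
  then show "D (root_of C) + min i (length vs - i) \<le> D (vs ! i)" by (simp add: l_def)
qed

text \<open>The shorter way round \<open>C\<close> uses at most half of its edges; doubling avoids
  halving odd lengths.\<close>

lemma D_le_root:
  assumes "C \<in> cycles" "x \<in> \<Union>C"
  shows "2 * D x \<le> 2 * D (root_of C) + card C"
proof -
  obtain vs where vs: "distinct vs" "length vs \<ge> 3" "cycle_edges vs = C" "set vs = \<Union>C" "vs ! 0 = root_of C"
    using cycleE[OF assms(1) root_of_in[OF assms(1)]] .
  obtain i where i: "i < length vs" "x = vs ! i" using assms(2) vs(4) by (metis in_set_conv_nth)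
  have "D x = D (root_of C) + min i (length vs - i)"
    using D_on_cycle[OF assms(1) vs(3,1,2,5) i(1)] i(2) by simp
  moreover have "card C = length vs" using card_cycle_edges[OF vs(1,2)] vs(3) by simp
  ultimately show ?thesis by linarith
qed

text \<open>Each parent cycle carries the walk from \<open>w\<close> to its root, where the
  induction continues. Root distances strictly decrease along the chain, so no cycle and no root
  occurs twice.\<close>

lemma parent_chain:
  assumes "w \<in> V"
  shows "\<exists>P\<subseteq>cycles. 2 * D w \<le> (\<Sum>C\<in>P. card C) \<and> (\<forall>C\<in>P. D (root_of C) < D w) \<and> inj_on root_of P"
  using assms
proof (induction "D w" arbitrary: w rule: less_induct)
  case less
  show ?case
  proof (cases "w = u")
    case True
    then show ?thesis using gdist_self[OF u_in_V] by (intro exI[of _ "{}"]) simp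
  next
    case False
    obtain C where C: "C \<in> cycles" "w \<in> \<Union>C" "D (root_of C) < D w"
      using parentE[OF less.prems False] by metis
    have "root_of C \<in> V" using C(1) root_of_in cycle_vertices by blast
    from less.hyps[OF C(3) this] obtain P where P: "P \<subseteq> cycles"
      "2 * D (root_of C) \<le> (\<Sum>C\<in>P. card C)" "\<forall>C'\<in>P. D (root_of C') < D (root_of C)" "inj_on root_of P"
      by blast
    have fin: "finite P" using P(1) finite_cycles finite_subset by blast
    have CP: "C \<notin> P" using P(3) by blast
    have "2 * D w \<le> (\<Sum>C\<in>insert C P. card C)"
      using D_le_root[OF C(1,2)] P(2) fin CP by simp
    moreover have "\<forall>C'\<in>insert C P. D (root_of C') < D w" using P(3) C(3) by fastforce
    moreover have "inj_on root_of (insert C P)" using P(3,4) CP by (auto simp: inj_on_insert)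
    ultimately show ?thesis using P(1) C(1) by (intro exI[of _ "insert C P"]) simp
  qed
qed

text \<open>At a vertex of cycle degree \<open>s\<close> at least \<open>s - 1\<close> cycles are rooted, and the chain from \<open>w\<close> to
  \<open>u\<close> uses at most one of these; every unused cycle has at least three edges.\<close>

lemma distance_excess:
  assumes "w \<in> V"
  shows "2 * D w + 3 * (\<Sum>x\<in>V. cycle_deg x - 2) \<le> card E"
proof -
  obtain P where P: "P \<subseteq> cycles" "2 * D w \<le> (\<Sum>C\<in>P. card C)" "inj_on root_of P"
    using parent_chain[OF assms] by blast
  have fP: "finite P" using P(1) finite_cycles finite_subset by blast
  let ?Q = "\<lambda>x. {C \<in> cycles - P. root_of C = x}"
  have local: "cycle_deg x - 2 \<le> card (?Q x)" if "x \<in> V" for x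
  proof -
    let ?N = "{C \<in> cycles. x \<in> \<Union>C \<and> root_of C \<noteq> x}" and ?R = "{C \<in> P. root_of C = x}"
    have N: "finite ?N" "card ?N \<le> 1"
    proof -
      show "finite ?N" using finite_cycles by simp
      moreover have "\<forall>C1\<in>?N. \<forall>C2\<in>?N. C1 = C2" 
        by (intro ballI parent_unique[of _ _ x]) simp_all
      ultimately show "card ?N \<le> 1"
        unfolding One_nat_def by (rule iffD2[OF card_le_Suc0_iff_eq])
    qed
    have R: "finite ?R" "card ?R \<le> 1"
    proof -
      show "finite ?R" using fP by simp
      moreover have "\<forall>C1\<in>?R. \<forall>C2\<in>?R. C1 = C2" using P(3) by (auto simp: inj_on_def)
      ultimately show "card ?R \<le> 1"
        unfolding One_nat_def by (rule iffD2[OF card_le_Suc0_iff_eq])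
    qed
    have Q: "finite (?Q x)" using finite_cycles by simp
    have "{C \<in> cycles. x \<in> \<Union>C} \<subseteq> ?N \<union> ?R \<union> ?Q x" by blast
    then have "cycle_deg x \<le> card (?N \<union> ?R \<union> ?Q x)"
      unfolding cycle_deg_def using N R Q by (intro card_mono) auto
    also have "\<dots> \<le> card ?N + card ?R + card (?Q x)"
      using card_Un_le[of "?N \<union> ?R" "?Q x"] card_Un_le[of ?N ?R] by linarith
    finally show ?thesis using N(2) R(2) by linarith
  qed
  have "(\<Sum>x\<in>V. cycle_deg x - 2) \<le> (\<Sum>x\<in>V. card (?Q x))" by (rule sum_mono) (rule local)
  also have "\<dots> = card (\<Union>x\<in>V. ?Q x)"
    by (rule card_UN_disjoint[symmetric]) (use finite_V finite_cycles in auto)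
  also have "\<dots> \<le> card (cycles - P)"
    by (rule card_mono) (use finite_cycles in auto)
  finally have "3 * (\<Sum>x\<in>V. cycle_deg x - 2) \<le> (\<Sum>C\<in>cycles - P. 3)" by simp
  also have "\<dots> \<le> (\<Sum>C\<in>cycles - P. card C)" by (rule sum_mono) (use card_cycle in auto)
  finally have "2 * D w + 3 * (\<Sum>x\<in>V. cycle_deg x - 2) \<le> (\<Sum>C\<in>P. card C) + (\<Sum>C\<in>cycles - P. card C)"
    using P(2) by simp
  also have "\<dots> = card E"
    unfolding card_E using sum.subset_diff[OF P(1) finite_cycles, of card] by simp
  finally show ?thesis .
qed

end

section \<open>Blocks and the BC-tree\<close>

lemma card_le_2I:
  assumes "finite S" "\<And>a b c. a \<in> S \<Longrightarrow> b \<in> S \<Longrightarrow> c \<in> S \<Longrightarrow> a = b \<or> a = c \<or> b = c"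
  shows "card S \<le> 2"
proof (rule ccontr)
  assume "\<not> card S \<le> 2"
  then have "3 \<le> card S" by simp
  then obtain T where "T \<subseteq> S" "card T = 3" using obtain_subset_with_card_n by metis
  then obtain a b c where "a \<in> S" "b \<in> S" "c \<in> S" "a \<noteq> b" "a \<noteq> c" "b \<noteq> c"
    by (auto simp: card_3_iff)
  then show False using assms(2) by blast
qed

lemma path_graph_neighbours:
  assumes "is_path_graph W F" "{a, b1} \<in> F" "{a, b2} \<in> F" "{a, b3} \<in> F"
  shows "b1 = b2 \<or> b1 = b3 \<or> b2 = b3"
proof -
  obtain vs where vs: "distinct vs" "F = {{vs ! i, vs ! (i + 1)} | i. i + 1 < length vs}"
    using assms(1) by (auto simp: is_path_graph_def)
  have edge: "\<exists>i. i + 1 < length vs \<and> (a = vs ! i \<and> b = vs ! (i + 1) \<or> a = vs ! (i + 1) \<and> b = vs ! i)"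
    if "{a, b} \<in> F" for b
    using that unfolding vs(2) by (auto simp: doubleton_eq_iff)
  obtain p where p: "p < length vs" "a = vs ! p"
    using edge[OF assms(2)] add_lessD1 by blast
  \<comment> \<open>For \<open>p = 0\<close> truncated subtraction makes the second alternative
    \<open>vs ! 0\<close>; this is harmless, as only the bound of two candidates matters.\<close>
  have "b = vs ! (p + 1) \<or> b = vs ! (p - 1)" if b: "{a, b} \<in> F" for b
  proof -
    obtain i where i: "i + 1 < length vs"
      "a = vs ! i \<and> b = vs ! (i + 1) \<or> a = vs ! (i + 1) \<and> b = vs ! i"
      using edge[OF b] by blast
    have "vs ! p = vs ! j \<longleftrightarrow> p = j" if "j < length vs" for j
      using that p(1) vs(1) by (simp add: nth_eq_iff_index_eq)
    from this[of i] this[of "i + 1"] show ?thesis using i p(2) by auto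
  qed
  from this[OF assms(2)] this[OF assms(3)] this[OF assms(4)] show ?thesis by blast
qed

context bridgeless_cactus
begin

text \<open>A cycle has no articulation point of its own. For maximality, an edge leaving
  \<open>C\<close> at \<open>x\<close> would lie on another cycle through \<open>x\<close>, and a
  larger graph without articulation points would join the two cycles around \<open>x\<close>,
  against \<open>cycles_separated\<close>.\<close>

lemma is_block_cycle:
  assumes C: "C \<in> cycles"
  shows "is_block V E (\<Union>C, C)"
proof -
  have "subgraph (\<Union>C) C V E"
    using cycle_vertices[OF C] cycle_subset_E[OF C] by (auto simp: subgraph_def)
  moreover have "connected_graph (\<Union>C) C"
    using cycle_nonempty[OF C] cycle_joined[OF C] by (auto simp: connected_graph_def)
  moreover have "\<forall>v\<in>\<Union>C. \<not> is_artic (\<Union>C) C v"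
    using cycle_minus_vertex_joined[OF C] unfolding is_artic_def by blast
  ultimately have cand: "block_cand V E (\<Union>C) C" by (simp add: block_cand_def)
  have "(W, F) = (\<Union>C, C)" if W: "block_cand V E W F" "\<Union>C \<subseteq> W" "C \<subseteq> F" for W F
  proof -
    have sub: "W \<subseteq> V" "F \<subseteq> E" "\<And>e. e \<in> F \<Longrightarrow> e \<subseteq> W"
      and conn: "\<And>a b. a \<in> W \<Longrightarrow> b \<in> W \<Longrightarrow> joined W F a b"
      and noart: "\<And>v a b. v \<in> W \<Longrightarrow> a \<in> W - {v} \<Longrightarrow> b \<in> W - {v} \<Longrightarrow>
         joined (W - {v}) {e \<in> F. v \<notin> e} a b"
      using W(1) unfolding block_cand_def subgraph_def connected_graph_def is_artic_def by blast+
    have noexit: False if yx: "{y, x} \<in> F" "y \<notin> \<Union>C" "x \<in> \<Union>C" for x y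
    proof -
      have "{y, x} \<in> E" using yx(1) sub(2) by blast
      then obtain C2 where C2: "C2 \<in> cycles" "{y, x} \<in> C2" by (rule edge_in_cycle)
      have ne: "C \<noteq> C2" using C2(2) yx(2) by blast
      obtain z where z: "{x, z} \<in> C" "z \<in> \<Union>C" "z \<noteq> x" using cycle_neighbour[OF C yx(3)] .
      have "y \<noteq> x" using yx by blast
      have "y \<in> W" using sub(3)[OF yx(1)] by blast
      then have "joined (W - {x}) {e \<in> F. x \<notin> e} z y"
        using noart[of x z y] z yx(3) W(2) \<open>y \<noteq> x\<close> by blast
      then have "joined (V - {x}) {e \<in> E. x \<notin> e} z y"
        by (rule joined_mono) (use sub in auto)
      moreover have "x \<in> \<Union>C2" "y \<in> \<Union>C2 - {x}" using C2(2) \<open>y \<noteq> x\<close> by auto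
      ultimately show False using cycles_separated[OF C C2(1) ne yx(3)] z by blast
    qed
    have WC: "W = \<Union>C"
    proof (rule ccontr)
      assume "W \<noteq> \<Union>C"
      then obtain w where w: "w \<in> W" "w \<notin> \<Union>C" using W(2) by blast
      obtain c where c: "c \<in> \<Union>C" using cycle_nonempty[OF C] by blast
      obtain xs where xs: "is_walk W F xs c w"
        using conn[of c w] w(1) c W(2) unfolding joined_def by blast
      have stays: "last xs \<in> \<Union>C" if "successively (\<lambda>a b. {a, b} \<in> F) xs" "hd xs \<in> \<Union>C" "xs \<noteq> []" for xs
        using that
      proof (induction xs)
        case (Cons x ys)
        show ?case
        proof (cases "ys = []")
          case False
          then have e: "{x, hd ys} \<in> F" "successively (\<lambda>a b. {a, b} \<in> F) ys"
            using Cons.prems by (auto simp: successively_Cons)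
          have "hd ys \<in> \<Union>C"
            using noexit[of "hd ys" x] e(1) Cons.prems(2) by (auto simp: insert_commute)
          then show ?thesis using Cons.IH e(2) False by simp
        qed (use Cons.prems in simp)
      qed simp
      from stays[of xs] have "w \<in> \<Union>C" using xs c unfolding is_walk_successively by blast
      then show False using w by blast
    qed
    \<comment> \<open>There are no chords: an edge with both ends on \<open>C\<close> lies on a
      cycle sharing two vertices with \<open>C\<close>, which is therefore \<open>C\<close>.\<close>
    have "F \<subseteq> C"
    proof
      fix e assume e: "e \<in> F"
      then have "e \<in> E" using sub by blast
      then obtain C2 where C2: "C2 \<in> cycles" "e \<in> C2" by (rule edge_in_cycle)
      obtain a b where ab: "e = {a, b}" "a \<noteq> b" using edgeE[OF \<open>e \<in> E\<close>] by metis
      have "a \<in> \<Union>C" "b \<in> \<Union>C" using sub(3)[OF e] ab WC by auto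
      moreover have "a \<in> \<Union>C2" "b \<in> \<Union>C2" using C2(2) ab by auto
      ultimately have "C2 = C" using cycle_eqI[OF C2(1) C] ab(2) by blast
      then show "e \<in> C" using C2 by simp
    qed
    then show ?thesis using WC W(3) by blast
  qed
  then show ?thesis using cand unfolding is_block_def fst_conv snd_conv by blast
qed

text \<open>A vertex on three cycles would be an articulation point with three neighbours in the
  BC-tree.\<close>

lemma bc_path_cycle_deg:
  assumes "bc_tree_is_path V E"
  shows "cycle_deg x \<le> 2"
  unfolding cycle_deg_def
proof (rule card_le_2I)
  show "finite {C \<in> cycles. x \<in> \<Union>C}" using finite_cycles by simp
  fix A B C assume *: "A \<in> {C \<in> cycles. x \<in> \<Union>C}" "B \<in> {C \<in> cycles. x \<in> \<Union>C}" "C \<in> {C \<in> cycles. x \<in> \<Union>C}"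
  show "A = B \<or> A = C \<or> B = C"
  proof (rule ccontr)
    assume ne: "\<not> (A = B \<or> A = C \<or> B = C)"
    then have "is_artic V E x" using artic_if_two_cycles[of A B x] * by blast
    then have "{Inl x, Inr (\<Union>D, D)} \<in> bc_edges V E" if "D \<in> {C \<in> cycles. x \<in> \<Union>C}" for D
      using that is_block_cycle[of D] unfolding bc_edges_def by (intro CollectI exI conjI) auto
    from path_graph_neighbours[OF assms[unfolded bc_tree_is_path_def] this[OF *(1)] this[OF *(2)] this[OF *(3)]]
    show False using ne by blast
  qed
qed

text \<open>The dual count: the block \<open>C\<close> has at most two neighbours in the
  BC-tree.\<close>

lemma bc_path_cycle_artics:
  assumes "bc_tree_is_path V E" "C \<in> cycles"
  shows "card {x \<in> \<Union>C. cycle_deg x \<ge> 2} \<le> 2"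
proof (rule card_le_2I)
  show "finite {x \<in> \<Union>C. cycle_deg x \<ge> 2}"
    by (rule finite_subset[OF _ finite_cycle_vertices[OF assms(2)]]) blast
  have e: "{Inr (\<Union>C, C), Inl x} \<in> bc_edges V E" if "x \<in> {x \<in> \<Union>C. cycle_deg x \<ge> 2}" for x
    using that is_block_cycle[OF assms(2)] artic_if_cycle_deg[of x]
    unfolding bc_edges_def insert_commute[of "Inr (\<Union>C, C)"] by (intro CollectI exI conjI) auto
  fix a b c assume "a \<in> {x \<in> \<Union>C. cycle_deg x \<ge> 2}" "b \<in> {x \<in> \<Union>C. cycle_deg x \<ge> 2}" "c \<in> {x \<in> \<Union>C. cycle_deg x \<ge> 2}"
  from path_graph_neighbours[OF assms(1)[unfolded bc_tree_is_path_def] e[OF this(1)] e[OF this(2)] e[OF this(3)]]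
  show "a = b \<or> a = c \<or> b = c" by blast
qed

lemma card_E_cycles: "card E + 1 = card V + card cycles"
proof -
  have "V \<noteq> {}" using card_V by auto
  then obtain u where "u \<in> V" by blast
  then interpret rooted_cactus V E u by unfold_locales
  show ?thesis by (rule card_E_eq)
qed

lemma sum_cycle_deg_minus_1: "(\<Sum>x\<in>V. cycle_deg x - 1) + 1 = card cycles"
proof -
  have "(\<Sum>x\<in>V. cycle_deg x - 1) + card V = (\<Sum>x\<in>V. cycle_deg x - 1 + 1)"
    by (simp only: sum.distrib card_eq_sum)
  also have "\<dots> = (\<Sum>x\<in>V. cycle_deg x)"
    by (rule sum.cong) (simp_all only: le_add_diff_inverse2[OF cycle_deg_pos])
  finally show ?thesis using card_E_cycles by (simp add: sum_cycle_deg)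
qed

text \<open>Suppose each of the k cycles had two vertices of cycle degree s at least 2. Counting
  incidences and using s \<le> 2 (s - 1) would give 2 k \<le> 2 (k - 1).\<close>

lemma leaf_cycle:
  assumes "\<And>x. cycle_deg x \<le> 2"
  obtains C where "C \<in> cycles" "card {x \<in> \<Union>C. cycle_deg x \<ge> 2} \<le> 1"
proof -
  let ?A = "{x \<in> V. cycle_deg x \<ge> 2}"
  have "\<exists>C\<in>cycles. card {x \<in> \<Union>C. cycle_deg x \<ge> 2} \<le> 1"
  proof (rule ccontr)
    assume "\<not> ?thesis"
    then have two: "2 \<le> card {x \<in> \<Union>C. cycle_deg x \<ge> 2}" if "C \<in> cycles" for C using that by force
    have "2 * card cycles = (\<Sum>C\<in>cycles. 2)" by simp
    also have "\<dots> \<le> (\<Sum>C\<in>cycles. card {x \<in> \<Union>C. cycle_deg x \<ge> 2})" by (rule sum_mono) (rule two)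
    also have "\<dots> = (\<Sum>C\<in>cycles. \<Sum>x | x \<in> ?A \<and> x \<in> \<Union>C. 1)"
    proof (rule sum.cong)
      fix C assume "C \<in> cycles"
      then have "{x. x \<in> ?A \<and> x \<in> \<Union>C} = {x \<in> \<Union>C. cycle_deg x \<ge> 2}" using cycle_vertices by blast
      then show "card {x \<in> \<Union>C. cycle_deg x \<ge> 2} = (\<Sum>x | x \<in> ?A \<and> x \<in> \<Union>C. 1)" by simp
    qed simp
    also have "\<dots> = (\<Sum>x\<in>?A. \<Sum>C | C \<in> cycles \<and> x \<in> \<Union>C. 1)"
      by (rule sum.swap_restrict[symmetric]) (use finite_V finite_cycles in auto)
    also have "\<dots> = (\<Sum>x\<in>?A. cycle_deg x)" by (simp add: cycle_deg_def)
    also have "\<dots> \<le> (\<Sum>x\<in>?A. 2 * (cycle_deg x - 1))" by (rule sum_mono) auto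
    also have "\<dots> \<le> (\<Sum>x\<in>V. 2 * (cycle_deg x - 1))"
      by (rule sum_mono2) (use finite_V in auto)
    also have "\<dots> = 2 * (\<Sum>x\<in>V. cycle_deg x - 1)" by (simp add: sum_distrib_left)
    finally show False using sum_cycle_deg_minus_1 by linarith
  qed
  with that show thesis by blast
qed

end

section \<open>Longitudinally symmetric chains\<close>

context rooted_cactus
begin

lemma root_of_containing_u:
  assumes "C \<in> cycles" "u \<in> \<Union>C"
  shows "root_of C = u"
  using D_root_less(2)[OF assms] by blast

lemma antipode_of_root:
  assumes "C \<in> cycles" "even (card C)"
  obtains w where "w \<in> \<Union>C" "2 * D w = 2 * D (root_of C) + card C"
proof -
  obtain vs where vs: "distinct vs" "length vs \<ge> 3" "cycle_edges vs = C" "set vs = \<Union>C" "vs ! 0 = root_of C"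
    using cycleE[OF assms(1) root_of_in[OF assms(1)]] .
  have l: "card C = length vs" using card_cycle_edges[OF vs(1,2)] vs(3) by simp
  let ?i = "length vs div 2"
  have i: "?i < length vs" using vs(2) by simp
  have "D (vs ! ?i) = D (root_of C) + min ?i (length vs - ?i)"
    using D_on_cycle[OF assms(1) vs(3,1,2,5) i] .
  moreover have "2 * min ?i (length vs - ?i) = length vs" using assms(2) l by (auto elim: evenE)
  ultimately have "2 * D (vs ! ?i) = 2 * D (root_of C) + card C" using l by simp
  moreover have "vs ! ?i \<in> \<Union>C" using i vs(4) nth_mem by blast
  ultimately show thesis by (intro that)
qed

text \<open>When \<open>u\<close> is antipodal to the only articulation point of a leaf cycle \<open>C0\<close>, the cycles are
  linearly ordered by the distance of their roots, and each one adds half its length to the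
  distance from \<open>u\<close>.\<close>

lemma chain_eccentricity:
  assumes deg: "\<And>x. cycle_deg x \<le> 2"
    and art: "\<And>C. C \<in> cycles \<Longrightarrow> card {x \<in> \<Union>C. cycle_deg x \<ge> 2} \<le> 2"
    and ev: "\<And>C. C \<in> cycles \<Longrightarrow> even (card C)"
    and anti: "\<And>C a b. C \<in> cycles \<Longrightarrow> a \<in> \<Union>C \<Longrightarrow> b \<in> \<Union>C \<Longrightarrow> cycle_deg a \<ge> 2 \<Longrightarrow> cycle_deg b \<ge> 2 \<Longrightarrow>
      a \<noteq> b \<Longrightarrow> 2 * gdist V E a b = card C"
    and C0: "C0 \<in> cycles" "u \<in> \<Union>C0" "cycle_deg u < 2" "{x \<in> \<Union>C0. cycle_deg x \<ge> 2} \<subseteq> {a}"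
      "2 * D a = card C0"
  obtains w where "w \<in> V" "2 * D w = card E"
proof -
  have only_C0: "C = C0" if "C \<in> cycles" "u \<in> \<Union>C" for C
    using cycle_deg_geI[OF that(1) C0(1) _ that(2) C0(2)] C0(3) by linarith
  have root_deg: "cycle_deg (root_of C) \<ge> 2" if C: "C \<in> cycles" "root_of C \<noteq> u" for C
  proof -
    have "root_of C \<in> V" using root_of_in[OF C(1)] cycle_vertices[OF C(1)] by blast
    then obtain C' where "C' \<in> cycles" "root_of C \<in> \<Union>C'" "root_of C' \<noteq> root_of C"
      using C(2) by (rule parentE)
    then show ?thesis using cycle_deg_geI[OF C(1), of C' "root_of C"] root_of_in[OF C(1)] by blast
  qed
  \<comment> \<open>A vertex of cycle degree at least 2 other than the root is antipodal to the
    root. In \<open>C0\<close> it can only be \<open>a\<close>; in any other cycle the root also has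
    cycle degree at least 2, so \<open>anti\<close> puts \<open>x\<close> half way round.\<close>
  have far: "2 * D x = 2 * D (root_of C) + card C"
    if C: "C \<in> cycles" "x \<in> \<Union>C" "root_of C \<noteq> x" "cycle_deg x \<ge> 2" for C x
  proof (cases "root_of C = u")
    case True
    then have "C = C0" using only_C0[OF C(1)] root_of_in[OF C(1)] by simp
    then have "x = a" using C C0(4) by blast
    then show ?thesis using True \<open>C = C0\<close> C0(5) gdist_self[OF u_in_V] by simp
  next
    case False
    obtain vs where vs: "distinct vs" "length vs \<ge> 3" "cycle_edges vs = C" "set vs = \<Union>C" "vs ! 0 = root_of C"
      using cycleE[OF C(1) root_of_in[OF C(1)]] .
    obtain i where i: "i < length vs" "x = vs ! i" using C(2) vs(4) by (metis in_set_conv_nth)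
    have l: "card C = length vs" using card_cycle_edges[OF vs(1,2)] vs(3) by simp
    have rV: "root_of C \<in> V" using root_of_in[OF C(1)] cycle_vertices[OF C(1)] by blast
    have "2 * gdist V E (root_of C) x = card C"
      using anti[OF C(1) root_of_in[OF C(1)] C(2) root_deg[OF C(1) False] C(4,3)] .
    moreover have "gdist V E (root_of C) x \<le> min i (length vs - i)"
      using gdist_along_cycle[of vs "root_of C" i] vs C(1) rV i gdist_self[OF rV] by simp
    moreover have "D x = D (root_of C) + min i (length vs - i)"
      using D_on_cycle[OF C(1) vs(3,1,2,5) i(1)] i(2) by simp
    ultimately show ?thesis using l by linarith
  qed
  \<comment> \<open>Outside \<open>C0\<close> the root already takes one of the two places that
    \<open>art\<close> allows.\<close>
  have child_root: "x = y"
    if C: "C \<in> cycles" and x: "x \<in> \<Union>C" "root_of C \<noteq> x" "cycle_deg x \<ge> 2"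
      and y: "y \<in> \<Union>C" "root_of C \<noteq> y" "cycle_deg y \<ge> 2" for C x y
  proof (cases "root_of C = u")
    case True
    then have "C = C0" using only_C0[OF C] root_of_in[OF C] by simp
    then show ?thesis using x y C0(4) by blast
  next
    case False
    show ?thesis
    proof (rule ccontr)
      assume "x \<noteq> y"
      then have "card {root_of C, x, y} = 3" using x y by simp
      moreover have "card {root_of C, x, y} \<le> card {x \<in> \<Union>C. cycle_deg x \<ge> 2}"
        using root_of_in[OF C] root_deg[OF C False] x y
        by (intro card_mono finite_subset[OF _ finite_cycle_vertices[OF C]]) blast+
      ultimately show False using art[OF C] by linarith
    qed
  qed
  \<comment> \<open>Two cycles rooted at the same vertex other than \<open>u\<close>, together with
    its parent cycle, would give cycle degree 3.\<close>
  have root_inj: "C1 = C2" if C: "C1 \<in> cycles" "C2 \<in> cycles" "root_of C1 = root_of C2" for C1 C2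
  proof (cases "root_of C1 = u")
    case True
    then show ?thesis
      using only_C0[OF C(1)] only_C0[OF C(2)] root_of_in[OF C(1)] root_of_in[OF C(2)] C(3) by simp
  next
    case False
    let ?r = "root_of C1"
    show ?thesis
    proof (rule ccontr)
      assume ne: "C1 \<noteq> C2"
      have "?r \<in> V" using root_of_in[OF C(1)] cycle_vertices[OF C(1)] by blast
      then obtain C' where C': "C' \<in> cycles" "?r \<in> \<Union>C'" "root_of C' \<noteq> ?r"
        using False by (rule parentE)
      then have "C1 \<noteq> C'" "C2 \<noteq> C'" using C(3) by auto
      then have "card {C1, C2, C'} = 3" using ne by simp
      moreover have "card {C1, C2, C'} \<le> cycle_deg ?r"
        unfolding cycle_deg_def
        using C C' root_of_in[OF C(1)] root_of_in[OF C(2)] finite_cycles by (intro card_mono) auto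
      ultimately show False using deg[of ?r] by linarith
    qed
  qed
  define child where "child C' C \<longleftrightarrow> C' \<in> cycles \<and> root_of C' \<in> \<Union>C \<and> root_of C' \<noteq> root_of C" for C' C
  have child_deg: "cycle_deg (root_of C') \<ge> 2" if ch: "child C' C" and C: "C \<in> cycles" for C' C
  proof (rule cycle_deg_geI[OF _ C])
    show "C' \<in> cycles" "root_of C' \<in> \<Union>C" "C' \<noteq> C" using ch by (auto simp: child_def)
    then show "root_of C' \<in> \<Union>C'" using root_of_in by blast
  qed
  have child_unique: "C1 = C2" if "child C1 C" "child C2 C" "C \<in> cycles" for C1 C2 C
  proof (rule root_inj)
    show "root_of C1 = root_of C2"
      using that child_deg[OF that(1,3)] child_deg[OF that(2,3)] unfolding child_def
      by (intro child_root[OF that(3)]) auto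
  qed (use that in \<open>auto simp: child_def\<close>)
  have rootC0: "root_of C0 = u" using root_of_containing_u[OF C0(1,2)] .
  \<comment> \<open>\<open>S\<close> is an initial segment of the chain and \<open>L\<close> its
    last cycle. The sum says that twice the distance from \<open>u\<close> to the far side of
    \<open>L\<close> is the total length of \<open>S\<close>, and only \<open>L\<close> may have a
    child outside \<open>S\<close>.\<close>
  have "\<exists>S L. S \<subseteq> cycles \<and> card S = Suc j \<and> C0 \<in> S \<and> L \<in> S \<and> 2 * D (root_of L) + card L = (\<Sum>C\<in>S. card C)
      \<and> (\<forall>C\<in>S - {L}. \<forall>C'. child C' C \<longrightarrow> C' \<in> S)" if "Suc j \<le> card cycles" for j
    using that
  proof (induction j)
    case 0
    show ?case
      using C0(1) rootC0 gdist_self[OF u_in_V] by (intro exI[of _ "{C0}"] exI[of _ C0]) simp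
  next
    case (Suc j)
    from Suc.IH[OF Suc_leD[OF Suc.prems]]
    obtain S L where S: "S \<subseteq> cycles" "card S = Suc j" "C0 \<in> S" "L \<in> S"
      and sum: "2 * D (root_of L) + card L = (\<Sum>C\<in>S. card C)"
      and closed': "\<forall>C\<in>S - {L}. \<forall>C'. child C' C \<longrightarrow> C' \<in> S"
      by (elim exE conjE)
    have closed: "C' \<in> S" if "C \<in> S - {L}" "child C' C" for C C' using closed' that by blast
    have fin: "finite S" using S(1) finite_cycles finite_subset by blast
    have "S \<noteq> cycles" using S(2) Suc.prems by auto
    then obtain C1 where "C1 \<in> cycles - S" using S(1) by blast
    then obtain C where C: "C \<in> cycles - S"
      and min: "\<And>C'. C' \<in> cycles - S \<Longrightarrow> D (root_of C) \<le> D (root_of C')"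
      using ex_has_least_nat[of "\<lambda>C. C \<in> cycles - S" C1 "\<lambda>C. D (root_of C)"] by blast
    have Cc: "C \<in> cycles" using C by blast
    have "root_of C \<noteq> u"
    proof
      assume "root_of C = u"
      then have "C = C0" using only_C0[OF Cc] root_of_in[OF Cc] by simp
      then show False using S(3) C by simp
    qed
    have "root_of C \<in> V" using root_of_in[OF Cc] cycle_vertices[OF Cc] by blast
    then obtain B where B: "B \<in> cycles" "root_of C \<in> \<Union>B" "root_of B \<noteq> root_of C"
      "D (root_of B) < D (root_of C)"
      using \<open>root_of C \<noteq> u\<close> by (rule parentE)
    have "B \<in> S"
    proof (rule ccontr)
      assume "B \<notin> S"
      with B(1) have "D (root_of C) \<le> D (root_of B)" by (intro min) simp
      with B(4) show False by simp
    qed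
    have ch: "child C B" using B Cc by (simp add: child_def)
    then have BL: "B = L" using closed[of B C] \<open>B \<in> S\<close> C by blast
    have "2 * D (root_of C) = 2 * D (root_of L) + card L"
      using far[OF B(1,2,3) child_deg[OF ch B(1)]] BL by simp
    then have "2 * D (root_of C) + card C = (\<Sum>C\<in>insert C S. card C)"
      using sum fin C by simp
    moreover have "\<forall>C''\<in>insert C S - {C}. \<forall>C'. child C' C'' \<longrightarrow> C' \<in> insert C S"
    proof (intro ballI allI impI)
      fix C'' C' assume *: "C'' \<in> insert C S - {C}" "child C' C''"
      show "C' \<in> insert C S"
      proof (cases "C'' = L")
        case True
        then show ?thesis using child_unique[OF _ ch B(1)] * BL by simp
      next
        case False
        then show ?thesis using closed[OF _ *(2)] *(1) by simp
      qed
    qed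
    moreover have "card (insert C S) = Suc (Suc j)" using S(2) fin C by simp
    moreover have "insert C S \<subseteq> cycles" "C0 \<in> insert C S" "C \<in> insert C S" using S Cc by auto
    ultimately show ?case by (intro exI conjI)
  qed
  note chain = this
  have "card cycles > 0" using C0(1) finite_cycles card_gt_0_iff by blast
  then have "Suc (card cycles - 1) = card cycles" by simp
  with chain[of "card cycles - 1"] obtain S L where S: "S \<subseteq> cycles" "card S = card cycles" "L \<in> S"
    and sum: "2 * D (root_of L) + card L = (\<Sum>C\<in>S. card C)"
    by (metis order_refl)
  have "S = cycles" using card_subset_eq[OF finite_cycles S(1,2)] .
  then have L: "L \<in> cycles" "2 * D (root_of L) + card L = card E" using S(3) sum card_E by auto
  obtain w where "w \<in> \<Union>L" "2 * D w = 2 * D (root_of L) + card L"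
    using antipode_of_root[OF L(1) ev[OF L(1)]] .
  then show thesis using L cycle_vertices[OF L(1)] by (intro that[of w]) auto
qed

end

context bridgeless_cactus
begin

text \<open>Supplies the start of the chain: rooting first at \<open>a\<close> yields the antipode
  \<open>u\<close> on a leaf cycle, and the cactus is then rooted again at \<open>u\<close>.\<close>

lemma eccentric_pair:
  assumes deg: "\<And>x. cycle_deg x \<le> 2"
    and art: "\<And>C. C \<in> cycles \<Longrightarrow> card {x \<in> \<Union>C. cycle_deg x \<ge> 2} \<le> 2"
    and ev: "\<And>C. C \<in> cycles \<Longrightarrow> even (card C)"
    and anti: "\<And>C a b. C \<in> cycles \<Longrightarrow> a \<in> \<Union>C \<Longrightarrow> b \<in> \<Union>C \<Longrightarrow> cycle_deg a \<ge> 2 \<Longrightarrow> cycle_deg b \<ge> 2 \<Longrightarrow>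
      a \<noteq> b \<Longrightarrow> 2 * gdist V E a b = card C"
  obtains u w where "u \<in> V" "w \<in> V" "2 * gdist V E u w = card E"
proof -
  obtain C0 where C0: "C0 \<in> cycles" "card {x \<in> \<Union>C0. cycle_deg x \<ge> 2} \<le> 1"
    using leaf_cycle[OF deg] .
  let ?A = "{x \<in> \<Union>C0. cycle_deg x \<ge> 2}"
  have "finite ?A" by (rule finite_subset[OF _ finite_cycle_vertices[OF C0(1)]]) blast
  then have one: "\<forall>x\<in>?A. \<forall>y\<in>?A. x = y"
    using C0(2) unfolding One_nat_def by (rule iffD1[OF card_le_Suc0_iff_eq])
  \<comment> \<open>If no vertex of \<open>C0\<close> has cycle degree at least 2, any vertex of it
    serves as \<open>a\<close>.\<close>
  obtain a where a: "a \<in> \<Union>C0" "?A \<subseteq> {a}"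
  proof (cases "?A = {}")
    case True
    then show thesis using that cycle_nonempty[OF C0(1)] by blast
  next
    case False
    then obtain a where "a \<in> ?A" by blast
    then show thesis using one by (intro that[of a]) blast+
  qed
  have aV: "a \<in> V" using a cycle_vertices[OF C0(1)] by blast
  interpret a: rooted_cactus V E a by unfold_locales (rule aV)
  obtain u where u: "u \<in> \<Union>C0" "2 * gdist V E a u = 2 * gdist V E a (a.root_of C0) + card C0"
    using a.antipode_of_root[OF C0(1) ev[OF C0(1)]] .
  then have ua: "2 * gdist V E a u = card C0"
    using a.root_of_containing_u[OF C0(1) a(1)] gdist_self[OF aV] by simp
  have "u \<noteq> a" using ua gdist_self[OF aV, of E] card_cycle(2)[OF C0(1)] by auto
  then have "cycle_deg u < 2" using u(1) a(2) by fastforce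
  have uV: "u \<in> V" using u cycle_vertices[OF C0(1)] by blast
  have "2 * gdist V E u a = card C0" using ua gdist_sym[OF connected[OF uV aV]] by simp
  interpret u: rooted_cactus V E u by unfold_locales (rule uV)
  obtain w where "w \<in> V" "2 * gdist V E u w = card E"
    by (rule u.chain_eccentricity[OF deg art ev anti C0(1) u(1) \<open>cycle_deg u < 2\<close> a(2)
          \<open>2 * gdist V E u a = card C0\<close>])
  then show thesis using uV by (intro that)
qed

section \<open>The bounds\<close>

lemma diameter_attained:
  obtains u w where "u \<in> V" "w \<in> V" "diameter V E = gdist V E u w"
    and "\<And>x y. x \<in> V \<Longrightarrow> y \<in> V \<Longrightarrow> gdist V E x y \<le> diameter V E"
proof -
  let ?S = "{gdist V E u v | u v. u \<in> V \<and> v \<in> V}"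
  have "?S = (\<lambda>(u, v). gdist V E u v) ` (V \<times> V)" by auto
  then have fin: "finite ?S" using finite_V by simp
  have "V \<noteq> {}" using card_V by auto
  then have "?S \<noteq> {}" by blast
  then have "diameter V E \<in> ?S" unfolding diameter_def by (rule Max_in[OF fin])
  moreover have "gdist V E x y \<le> diameter V E" if "x \<in> V" "y \<in> V" for x y
    unfolding diameter_def by (rule Max_ge[OF fin]) (use that in blast)
  ultimately show thesis using that by blast
qed

lemma diameter_excess: "2 * diameter V E + 3 * (\<Sum>x\<in>V. cycle_deg x - 2) \<le> card E"
proof -
  obtain u w where uw: "u \<in> V" "w \<in> V" "diameter V E = gdist V E u w" by (rule diameter_attained)
  interpret rooted_cactus V E u by unfold_locales (rule uw)
  show ?thesis using distance_excess[OF uw(2)] uw(3) by simp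
qed

lemma sum_sqrt_cycle_deg_ge:
  "(\<Sum>x\<in>V. sqrt (real (cycle_deg x))) \<ge> real (card E) - (real (card cycles) - 1) * (2 - sqrt 2)
     - (sqrt 2 - 1) * real (\<Sum>x\<in>V. cycle_deg x - 2)"
proof -
  \<comment> \<open>The right-hand side is 1 for s = 1 and constantly sqrt 2 for s at least
    2.\<close>
  have pt: "sqrt (real s) \<ge> real s - real (s - 1) * (2 - sqrt 2) - (sqrt 2 - 1) * real (s - 2)"
    if "s \<ge> 1" for s :: nat
  proof (cases "s = 1")
    case False
    with that have s: "s \<ge> 2" by simp
    then have "real (s - 1) = real s - 1" "real (s - 2) = real s - 2" by auto
    then have "real s - real (s - 1) * (2 - sqrt 2) - (sqrt 2 - 1) * real (s - 2) = sqrt 2"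
      by (simp add: algebra_simps)
    then show ?thesis using s by simp
  qed simp
  have "real (card cycles) - 1 = real (\<Sum>x\<in>V. cycle_deg x - 1)"
    using sum_cycle_deg_minus_1 by linarith
  then have "real (card E) - (real (card cycles) - 1) * (2 - sqrt 2) - (sqrt 2 - 1) * real (\<Sum>x\<in>V. cycle_deg x - 2)
     = (\<Sum>x\<in>V. real (cycle_deg x) - real (cycle_deg x - 1) * (2 - sqrt 2) - (sqrt 2 - 1) * real (cycle_deg x - 2))"
    by (simp add: sum_subtractf sum_distrib_left sum_distrib_right flip: sum_cycle_deg)
  also have "\<dots> \<le> (\<Sum>x\<in>V. sqrt (real (cycle_deg x)))"
    by (rule sum_mono) (rule pt[OF cycle_deg_pos])
  finally show ?thesis .
qed

lemma sum_sqrt_cycle_deg_eq: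
  assumes "\<And>x. cycle_deg x \<le> 2"
  shows "(\<Sum>x\<in>V. sqrt (real (cycle_deg x))) = real (card E) - (real (card cycles) - 1) * (2 - sqrt 2)"
proof -
  have "real (card cycles) - 1 = real (\<Sum>x\<in>V. cycle_deg x - 1)"
    using sum_cycle_deg_minus_1 by linarith
  then have "real (card E) - (real (card cycles) - 1) * (2 - sqrt 2)
     = (\<Sum>x\<in>V. real (cycle_deg x) - real (cycle_deg x - 1) * (2 - sqrt 2))"
    by (simp add: sum_subtractf sum_distrib_right flip: sum_cycle_deg)
  also have "\<dots> = (\<Sum>x\<in>V. sqrt (real (cycle_deg x)))"
  proof (rule sum.cong)
    fix x assume "x \<in> V"
    then have "cycle_deg x = 1 \<or> cycle_deg x = 2" using cycle_deg_pos[of x] assms[of x] by linarith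
    then show "real (cycle_deg x) - real (cycle_deg x - 1) * (2 - sqrt 2) = sqrt (real (cycle_deg x))" by auto
  qed simp
  finally show ?thesis by simp
qed

lemma randic_lower_bound:
  "randic E \<ge> real (diameter V E) / 2 + real (card E) / 4 - (real (card cycles) - 1) * (2 - sqrt 2)"
proof -
  define q where "q = real (\<Sum>x\<in>V. cycle_deg x - 2)"
  \<comment> \<open>This gives sqrt 2 - 1 \<le> 3/4, where 3/4 is the coefficient of
    \<open>q\<close> in \<open>diameter_excess\<close> after division by 4; the loss in the square
    root estimate is thus absorbed.\<close>
  have "sqrt 2 \<le> 7 / 4" by (rule real_le_lsqrt) (simp_all add: power2_eq_square)
  then have "(sqrt 2 - 1) * q \<le> 3 / 4 * q" by (intro mult_right_mono) (simp_all add: q_def sum_nonneg)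
  moreover have "2 * real (diameter V E) + 3 * q \<le> real (card E)"
    using diameter_excess unfolding q_def by linarith
  ultimately show ?thesis
    using randic_ge sum_sqrt_cycle_deg_ge unfolding q_def[symmetric] by linarith
qed

lemma symmetric_path_equalities:
  assumes path: "bc_tree_is_path V E" and sym: "long_symmetric V E"
  shows "randic E = real (card E) / 2 - (real (card cycles) - 1) * (2 - sqrt 2)"
    and "2 * diameter V E = card E"
proof -
  have ev: "even (card C)" if "C \<in> cycles" for C
    using sym that card_cycle(1)[OF that] unfolding long_symmetric_def by metis
  have anti: "2 * gdist V E a b = card C"
    if "C \<in> cycles" "a \<in> \<Union>C" "b \<in> \<Union>C" "cycle_deg a \<ge> 2" "cycle_deg b \<ge> 2" "a \<noteq> b" for C a b
    using sym that card_cycle(1)[OF that(1)] artic_if_cycle_deg unfolding long_symmetric_def by metis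
  \<comment> \<open>Adjacent vertices are at distance at most 1, whereas symmetry would put two
    articulation points of a cycle at least 3/2 apart.\<close>
  have "cycle_deg a = 1 \<or> cycle_deg b = 1" if ab: "{a, b} \<in> E" "a \<noteq> b" for a b
  proof (rule ccontr)
    assume "\<not> ?thesis"
    moreover have V: "a \<in> V" "b \<in> V" using edgeE[OF ab(1)] by (metis doubleton_eq_iff)+
    ultimately have ge: "cycle_deg a \<ge> 2" "cycle_deg b \<ge> 2" using cycle_deg_pos[of a] cycle_deg_pos[of b] by auto
    obtain C where C: "C \<in> cycles" "{a, b} \<in> C" using edge_in_cycle[OF ab(1)] .
    then have "2 * gdist V E a b = card C" using anti[OF C(1) _ _ ge ab(2)] by blast
    moreover have "gdist V E a b \<le> 1" using gdist_le[OF is_walk_edge[OF ab(1) V]] by simp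
    ultimately show False using card_cycle(2)[OF C(1)] by linarith
  qed
  then show "randic E = real (card E) / 2 - (real (card cycles) - 1) * (2 - sqrt 2)"
    using randic_eq sum_sqrt_cycle_deg_eq[OF bc_path_cycle_deg[OF path]] by simp
  obtain u w where uw: "u \<in> V" "w \<in> V" "2 * gdist V E u w = card E"
    by (rule eccentric_pair[OF bc_path_cycle_deg[OF path] bc_path_cycle_artics[OF path] ev anti])
  have "gdist V E u w \<le> diameter V E" using diameter_attained uw(1,2) by metis
  then show "2 * diameter V E = card E" using uw(3) diameter_excess by linarith
qed

end

theorem theorem5p2:
  fixes V :: "'a set" and E :: "'a set set"
  assumes "nontrivial_cactus V E"
    and "card V \<ge> 2"
  shows "randic E - real (diameter V E)
           \<ge> - (real (card (graph_cycles V E)) - 1) * (2 - sqrt 2)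
     \<and> randic E - real (diameter V E) / 2
           \<ge> real (card V) / 4 - (real (card (graph_cycles V E)) - 1) * (7 / 4 - sqrt 2)
     \<and> (bc_tree_is_path V E \<and> long_symmetric V E \<longrightarrow>
          randic E - real (diameter V E)
            = - (real (card (graph_cycles V E)) - 1) * (2 - sqrt 2)
        \<and> randic E - real (diameter V E) / 2
            = real (card V) / 4 - (real (card (graph_cycles V E)) - 1) * (7 / 4 - sqrt 2))"
proof -
  interpret bridgeless_cactus V E by unfold_locales (rule assms)+
  define k where "k = (real (card cycles) - 1) * (2 - sqrt 2)"
  have neg: "- (real (card cycles) - 1) * (2 - sqrt 2) = - k"
    unfolding k_def by (rule mult_minus_left)
  \<comment> \<open>Writing n = m - (k - 1) moves a quarter of k - 1 into the other term, and 7/4 +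
    1/4 = 2 makes the two correction terms agree.\<close>
  have "real (card V) = real (card E) - (real (card cycles) - 1)" using card_E_cycles by linarith
  then have shift: "real (card V) / 4 - (real (card cycles) - 1) * (7 / 4 - sqrt 2) = real (card E) / 4 - k"
    by (simp add: k_def field_simps)
  \<comment> \<open>The second bound is \<open>randic_lower_bound\<close> itself; replacing m/4 by
    the smaller d/2 there gives the first.\<close>
  have diam: "2 * real (diameter V E) \<le> real (card E)" using diameter_excess by linarith
  have "randic E = real (card E) / 2 - k" "2 * real (diameter V E) = real (card E)"
    if "bc_tree_is_path V E" "long_symmetric V E"
    using symmetric_path_equalities[OF that] unfolding k_def by linarith+
  then show ?thesis
    unfolding neg shift using randic_lower_bound[folded k_def] diam by fastforce
qed

end
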